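(* Let $\mathfrak h$ be the limiting height function (the minimizer of the surface tension functional) of the uniform domino tiling model on a planar domain $\Omega$, let $\mathcal L\subset\Omega$ be its liquid region, and let $P(z,w)=1+z+w-zw$. Then in $\mathcal L$ there are defined two (complex-valued, non-vanishing) functions $z(x,y)$, $w(x,y)$ satisfying the following properties: 1. $\nabla\mathfrak h=\frac1\pi\,(\arg w,\,-\arg z)$; 2. (Ampère's equation) $\dfrac{z_x}{z}+\dfrac{w_y}{w}=0$; 3. (spectral curve equation) $P(z,w)=0$.
   Context: Subscripts $x,y$ denote partial derivatives, and $\arg$ denotes the argument of a non-zero complex number. **Ronkin function and surface tension.** For $P(z,w)=1+z+w-zw$ let $$\mathcal R(X,Y)=\frac1{(2\pi i)^2}\iint_{|z|=|w|=1}\log|P(e^Xz,e^Yw)|\,\frac{dz}{z}\frac{dw}{w},\qquad (X,Y)\in\mathbb R^2 .$$ The set of allowed slopes is the Newton polygon $\mathcal N$ of $P$, the unit square with vertices $(0,0),(1,0),(0,1),(1,1)$. The surface tension $\sigma:\mathcal N\to\mathbb R$ is the Legendre transform $\sigma(s,t)=\sup_{X,Y}\big(sX+tY-\mathcal R(X,Y)\big)$; it is smooth and strictly convex on the interior of $\mathcal N$. **Minimizer and liquid region.** $\Omega\subset\mathbb R^2$ is a bounded domain and $\mathfrak h:\Omega\to\mathbb R$ is the minimizer of $\int_\Omega\sigma(\nabla h)\,dx\,dy$ among Lipschitz functions $h$ with $\nabla h\in\mathcal N$ almost everywhere and given boundary conditions. The liquid region $\mathcal L$ is the open subset of $\Omega$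 where $\nabla\mathfrak h$ lies in the interior of $\mathcal N$. There $\mathfrak h$ is smooth and satisfies the Euler–Lagrange equation $\partial_x\big(\sigma_s(\nabla\mathfrak h)\big)+\partial_y\big(\sigma_t(\nabla\mathfrak h)\big)=0$. *)

theory Defs
  imports "HOL-Analysis.Analysis"
begin

text \<open>Functions of two real variables are functions on \<^typ>\<open>real \<times> real\<close>. The partial
  derivatives are used both for real-valued and for complex-valued functions.\<close>

definition partial_x :: "(real \<times> real \<Rightarrow> 'a::real_normed_vector) \<Rightarrow> real \<times> real \<Rightarrow> 'a" where
  "partial_x f p = vector_derivative (\<lambda>u. f (u, snd p)) (at (fst p))"

definition partial_y :: "(real \<times> real \<Rightarrow> 'a::real_normed_vector) \<Rightarrow> real \<times> real \<Rightarrow> 'a" where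
  "partial_y f p = vector_derivative (\<lambda>v. f (fst p, v)) (at (snd p))"

definition gradient :: "(real \<times> real \<Rightarrow> real) \<Rightarrow> real \<times> real \<Rightarrow> real \<times> real" where
  "gradient f p = (partial_x f p, partial_y f p)"

text \<open>\<^term>\<open>k\<close> times continuously differentiable; meant for open \<^term>\<open>U\<close>.\<close>

primrec Ck_on :: "nat \<Rightarrow> (real \<times> real) set \<Rightarrow> (real \<times> real \<Rightarrow> real) \<Rightarrow> bool" where
  "Ck_on 0 U f \<longleftrightarrow> continuous_on U f"
| "Ck_on (Suc k) U f \<longleftrightarrow>
     (\<forall>p\<in>U. f differentiable (at p)) \<and> Ck_on k U (partial_x f) \<and> Ck_on k U (partial_y f)"

definition smooth_on :: "(real \<times> real) set \<Rightarrow> (real \<times> real \<Rightarrow> real) \<Rightarrow> bool" where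
  "smooth_on U f \<longleftrightarrow> (\<forall>k. Ck_on k U f)"

definition domino_poly :: "complex \<Rightarrow> complex \<Rightarrow> complex" where
  "domino_poly z w = 1 + z + w - z * w"

definition newton_polygon :: "(real \<times> real) set" where
  "newton_polygon = convex hull {(0, 0), (1, 0), (0, 1), (1, 1)}"

text \<open>The integral over the torus is written in the angles \<open>z = cis a\<close>, \<open>w = cis b\<close>, for which
  \<open>dz / (2 \<pi> \<i> z) = da / (2 \<pi>)\<close> and \<open>dw / (2 \<pi> \<i> w) = db / (2 \<pi>)\<close>. The zeros of the
  polynomial on the torus form a null set, so the value of \<^term>\<open>ln 0\<close> plays no role.\<close>

definition ronkin :: "real \<Rightarrow> real \<Rightarrow> real" where
  "ronkin X Y = 1 / (2 * pi)\<^sup>2 *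
     (LINT (a, b) : {0..2 * pi} \<times> {0..2 * pi} | lborel.
        ln (cmod (domino_poly (of_real (exp X) * cis a) (of_real (exp Y) * cis b))))"

text \<open>Only used on the Newton polygon, where the supremum is finite.\<close>

definition surface_tension :: "real \<times> real \<Rightarrow> real" where
  "surface_tension = (\<lambda>(s, t). SUP (X, Y). s * X + t * Y - ronkin X Y)"

text \<open>A Lipschitz function on \<^term>\<open>\<Omega>\<close> extends uniquely, with the same constant, to the
  closure; the boundary condition \<^term>\<open>b\<close> is imposed on this extension.\<close>

definition admissible ::
  "(real \<times> real) set \<Rightarrow> (real \<times> real \<Rightarrow> real) \<Rightarrow> (real \<times> real \<Rightarrow> real) \<Rightarrow> bool" where
  "admissible \<Omega> b g \<longleftrightarrow>
     (\<exists>C. C-lipschitz_on (closure \<Omega>) g) \<and>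
     (AE p in lebesgue. p \<in> \<Omega> \<longrightarrow> g differentiable (at p) \<and> gradient g p \<in> newton_polygon) \<and>
     (\<forall>p\<in>frontier \<Omega>. g p = b p)"

definition total_tension :: "(real \<times> real) set \<Rightarrow> (real \<times> real \<Rightarrow> real) \<Rightarrow> real" where
  "total_tension \<Omega> g = (LINT p : \<Omega> | lebesgue. surface_tension (gradient g p))"

definition minimizer ::
  "(real \<times> real) set \<Rightarrow> (real \<times> real \<Rightarrow> real) \<Rightarrow> (real \<times> real \<Rightarrow> real) \<Rightarrow> bool" where
  "minimizer \<Omega> b h \<longleftrightarrow>
     admissible \<Omega> b h \<and> (\<forall>g. admissible \<Omega> b g \<longrightarrow> total_tension \<Omega> h \<le> total_tension \<Omega> g)"

definition liquid_region ::
  "(real \<times> real) set \<Rightarrow> (real \<times> real \<Rightarrow> real) \<Rightarrow> (real \<times> real) set" where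
  "liquid_region \<Omega> h =
     {p \<in> \<Omega>. h differentiable (at p) \<and> gradient h p \<in> interior newton_polygon}"

definition euler_lagrange_on :: "(real \<times> real) set \<Rightarrow> (real \<times> real \<Rightarrow> real) \<Rightarrow> bool" where
  "euler_lagrange_on U h \<longleftrightarrow>
     (\<forall>p\<in>U. partial_x (\<lambda>q. partial_x surface_tension (gradient h q)) p
          + partial_y (\<lambda>q. partial_y surface_tension (gradient h q)) p = 0)"

end

(* Set z = exp (X + i a). By Jensen's formula in w the Ronkin function is the mean over a of
   ln (max |1 + z| (e^Y |1 - z|)), which gives explicit supporting planes: for 0 < s, t < 1 the
   supremum defining the surface tension is attained where
     sinh X = - cot (pi s) sin (pi t)  and  sinh Y = - cot (pi t) sin (pi s),
   so its gradient at (s, t) is (X, Y). Put z = exp (- X - i pi t) and w = exp (- Y + i pi s) at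
   (s, t) = grad h. Then P(z, w) = 0 is a trigonometric identity, the real part of Ampere's
   equation is the Euler-Lagrange equation, and its imaginary part is h_xy = h_yx. *)
theory Submission
  imports Defs "HOL-Complex_Analysis.Cauchy_Integral_Formula"
begin

subsection \<open>Jensen's formula and the Ronkin function\<close>

text \<open>Neither \<open>ronkin\<close> nor \<open>surface_tension\<close> is evaluated in closed
  form. The obstacle is that the angle at which the two branches of the maximum cross moves with (X,
  Y). Supporting planes avoid differentiating through it, and they are used twice: for the Ronkin
  function they identify the maximizer in the Legendre transform, and for the surface tension a
  continuous family of them is its gradient. The signs in z and w come from a symmetry of the curve.
  At the dual point the branches cross at the angle pi (1 - t), so z0 = exp (X + i pi (1 - t)) has a
  partner w0 on the curve with |w0| = exp Y. Since P(-1/z, -1/w) = - P(z, w) / (z w) and P has real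
  coefficients, the curve is preserved by (z, w) -> (-1/conj z, -1/conj w). The image of (z0, w0) is
  the pair used in the theorem, with arguments - pi t and pi s.\<close>

lemma has_integral_ln_cmod_one_add:
  assumes "cmod v < 1"
  shows "((\<lambda>t. ln (cmod (1 + v * cis t))) has_integral 0) {0..2 * pi}"
proof -
  have pos: "1 + v * u \<notin> \<real>\<^sub>\<le>\<^sub>0" if "cmod u \<le> 1" for u
  proof -
    have "cmod (v * u) < 1"
      using that assms by (metis mult_le_cancel_left2 norm_ge_zero norm_mult not_le order_le_less_trans)
    then have "Re (1 + v * u) > 0"
      using abs_Re_le_cmod[of "v * u"] by (simp only: plus_complex.simps one_complex.simps)
    then show ?thesis
      by (auto simp: complex_nonpos_Reals_iff)
  qed
  have hol: "(\<lambda>u. Ln (1 + v * u)) holomorphic_on cball 0 1"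
    by (intro holomorphic_intros pos) auto
  \<comment> \<open>On the unit circle du / u = i dt, so Cauchy's formula at the centre gives the
    mean of the logarithm as Ln 1 = 0. Because of the factor i, the imaginary part taken below is
    the real part of \<open>Ln\<close>, which is \<open>ln\<close> of the modulus.\<close>
  have "((\<lambda>u. Ln (1 + v * u) / (u - 0)) has_contour_integral 2 * of_real pi * \<i> * Ln (1 + v * 0))
      (circlepath 0 1)"
    by (rule Cauchy_integral_circlepath_simple[OF hol]) auto
  then have "((\<lambda>t. Ln (1 + v * cis t) * \<i>) has_integral 0) {0..2 * pi}"
    by (simp add: circlepath_def has_contour_integral_part_circlepath_iff)
  then have "((Im \<circ> (\<lambda>t. Ln (1 + v * cis t) * \<i>)) has_integral Im 0) {0..2 * pi}"
    by (rule has_integral_linear) (rule bounded_linear_Im)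
  moreover have "1 + v * cis t \<noteq> 0" for t
    using pos[of "cis t"] by auto
  ultimately show ?thesis
    by (simp add: o_def)
qed

lemma add_mult_cis_neq_0:
  assumes "cmod u \<noteq> cmod v"
  shows "u + v * cis t \<noteq> 0"
proof
  assume "u + v * cis t = 0"
  then have "cmod u = cmod (v * cis t)"
    by (metis add_eq_0_iff norm_minus_cancel)
  with assms show False
    by (simp add: norm_mult)
qed

text \<open>Factoring out the larger coefficient leaves 1 + x cis t with |x| < 1, whose logarithm
  has mean zero. If the larger coefficient is \<open>v\<close>, the remaining factor contains cis (-
  t); conjugation keeps its modulus and restores cis t.\<close>

lemma has_integral_ln_cmod_linear:
  assumes "cmod u \<noteq> cmod v"
  shows "((\<lambda>t. ln (cmod (u + v * cis t))) has_integral 2 * pi * ln (max (cmod u) (cmod v)))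
    {0..2 * pi}"
proof -
  have main: "((\<lambda>t. ln c + ln (cmod (1 + x * cis t))) has_integral 2 * pi * ln c) {0..2 * pi}"
    if "cmod x < 1" for x c
    using has_integral_add[OF has_integral_const_real[of "ln c" 0 "2 * pi"]
        has_integral_ln_cmod_one_add[OF that]] by simp
  have nz: "u + v * cis t \<noteq> 0" for t
    using assms by (rule add_mult_cis_neq_0)
  consider "cmod v < cmod u" | "cmod u < cmod v"
    using assms by linarith
  then show ?thesis
  proof cases
    case 1
    then have u: "u \<noteq> 0" by auto
    have eq: "ln (cmod (u + v * cis t)) = ln (cmod u) + ln (cmod (1 + v / u * cis t))" for t
    proof -
      have "u + v * cis t = u * (1 + v / u * cis t)"
        using u by (simp add: field_simps)
      with nz[of t] show ?thesis
        by (simp add: norm_mult ln_mult)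
    qed
    show ?thesis
      unfolding eq using main[of "v / u" "cmod u"] 1 u by (simp add: norm_divide max_def)
  next
    case 2
    then have v: "v \<noteq> 0" by auto
    have eq: "ln (cmod (u + v * cis t)) = ln (cmod v) + ln (cmod (1 + cnj (u / v) * cis t))" for t
    proof -
      have "u + v * cis t = v * cis t * cnj (1 + cnj (u / v) * cis t)"
        using v cis_neq_zero[of t] by (simp add: field_simps cis_cnj cis_divide flip: cis_inverse)
      then have "cmod (u + v * cis t) = cmod v * cmod (1 + cnj (u / v) * cis t)"
        by (metis complex_mod_cnj norm_cis norm_mult mult.right_neutral)
      with nz[of t] v show ?thesis
        by (metis ln_mult mult_zero_right norm_eq_zero zero_less_norm_iff)
    qed
    show ?thesis
      unfolding eq using main[of "cnj (u / v)" "cmod v"] 2 v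
      by (simp add: norm_divide max_def)
  qed
qed

text \<open>Serves to show that the angles at which the two coefficients in Jensen's formula have
  equal modulus form a null set.\<close>

lemma finite_cos_eq: "finite {a \<in> {0..2 * pi}. cos a = c}"
proof (rule finite_subset)
  show "{a \<in> {0..2 * pi}. cos a = c} \<subseteq> {arccos c, 2 * pi - arccos c}"
  proof (clarsimp)
    fix a assume a: "0 \<le> a" "a \<le> 2 * pi" "a \<noteq> arccos (cos a)"
    then have "a > pi"
      using arccos_cos by force
    then have "arccos (cos (2 * pi - a)) = 2 * pi - a"
      using a by (intro arccos_cos) auto
    then show "a = 2 * pi - arccos (cos a)"
      by simp
  qed
qed auto

section \<open>The moduli of 1 + z and 1 - z on a circle |z| = exp X\<close>

lemma cmod_one_add_exp_cis:
  "(cmod (1 + of_real (exp X) * cis a))\<^sup>2 = 1 + (exp X)\<^sup>2 + 2 * exp X * cos a"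
proof -
  have "(cmod (1 + of_real (exp X) * cis a))\<^sup>2
      = 1 + 2 * exp X * cos a + (exp X)\<^sup>2 * ((sin a)\<^sup>2 + (cos a)\<^sup>2)"
    unfolding cmod_power2 by (simp add: power2_eq_square algebra_simps del: sin_cos_squared_add sin_cos_squared_add3)
  then show ?thesis by simp
qed

lemma cmod_one_diff_exp_cis:
  "(cmod (1 - of_real (exp X) * cis a))\<^sup>2 = 1 + (exp X)\<^sup>2 - 2 * exp X * cos a"
proof -
  have "(cmod (1 - of_real (exp X) * cis a))\<^sup>2
      = 1 - 2 * exp X * cos a + (exp X)\<^sup>2 * ((sin a)\<^sup>2 + (cos a)\<^sup>2)"
    unfolding cmod_power2 by (simp add: power2_eq_square algebra_simps del: sin_cos_squared_add sin_cos_squared_add3)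
  then show ?thesis by simp
qed

definition ronkin_fiber :: "real \<Rightarrow> real \<Rightarrow> real \<Rightarrow> real" where
  "ronkin_fiber X Y a = ln (max (cmod (1 + of_real (exp X) * cis a))
     (exp Y * cmod (1 - of_real (exp X) * cis a)))"

text \<open>1 + z and 1 - z have no common zero. Hence the fiber function is continuous even at
  angles where one of the branches vanishes.\<close>

lemma ronkin_fiber_arg_pos:
  "max (cmod (1 + of_real (exp X) * cis a)) (exp Y * cmod (1 - of_real (exp X) * cis a)) > 0"
proof (cases "1 + of_real (exp X) * cis a = 0")
  case True
  then have "of_real (exp X) * cis a = -1"
    by (metis add_eq_0_iff)
  then show ?thesis by auto
qed (auto simp: less_max_iff_disj)

lemma continuous_on_ronkin_fiber: "continuous_on A (ronkin_fiber X Y)"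
  unfolding ronkin_fiber_def using ronkin_fiber_arg_pos
  by (intro continuous_intros) (auto simp: less_imp_neq[symmetric] simp del: less_max_iff_disj)

lemma set_lebesgue_integral_eq_has_integral:
  fixes f :: "real \<Rightarrow> real"
  assumes "continuous_on {a..b} f" "(f has_integral I) {a..b}"
  shows "(LINT x : {a..b} | lborel. f x) = I"
  using set_borel_integral_eq_integral(2)[OF borel_integrable_atLeastAtMost'[OF assms(1)]] assms(2)
  by (simp add: integral_unique)

text \<open>Jensen's formula evaluates the integral over \<open>w\<close> of the logarithm of
  \<open>(1 + z) + w (1 - z)\<close>. Fubini's theorem is applied to a constant minus this logarithm, so that
  the integrand is nonnegative in spite of the singularities at the zeros on the torus.\<close>

lemma ronkin_eq_integral_fiber:
  "ronkin X Y = 1 / (2 * pi) * integral {0..2 * pi} (ronkin_fiber X Y)"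
proof -
  define f where "f a b = ln (cmod (domino_poly (of_real (exp X) * cis a) (of_real (exp Y) * cis b)))"
    for a b
  define I :: "real \<Rightarrow> real" where "I = indicator {0..2 * pi}"
  define C where "C = 1 + exp X + exp Y + exp X * exp Y"
  define N where "N = {a \<in> {0..2 * pi}. cmod (1 + of_real (exp X) * cis a)
    = exp Y * cmod (1 - of_real (exp X) * cis a)}"
  have P: "domino_poly (of_real (exp X) * cis a) (of_real (exp Y) * cis b)
      = (1 + of_real (exp X) * cis a) + (of_real (exp Y) * (1 - of_real (exp X) * cis a)) * cis b"
    for a b by (simp add: domino_poly_def algebra_simps)
  \<comment> \<open>Once squared, the equation defining \<open>N\<close> is affine in
    \<open>cos a\<close> with a nonzero coefficient, so it admits a single value of
    \<open>cos a\<close>.\<close>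
  have "N \<subseteq> {a \<in> {0..2 * pi}. cos a = ((exp Y)\<^sup>2 * (1 + (exp X)\<^sup>2) - (1 + (exp X)\<^sup>2))
      / (2 * exp X * (1 + (exp Y)\<^sup>2))}"
  proof (clarsimp simp: N_def)
    fix a assume "cmod (1 + of_real (exp X) * cis a) = exp Y * cmod (1 - of_real (exp X) * cis a)"
    then have "(cmod (1 + of_real (exp X) * cis a))\<^sup>2
        = (exp Y)\<^sup>2 * (cmod (1 - of_real (exp X) * cis a))\<^sup>2"
      by (simp add: power_mult_distrib)
    then have "1 + (exp X)\<^sup>2 + 2 * exp X * cos a = (exp Y)\<^sup>2 * (1 + (exp X)\<^sup>2 - 2 * exp X * cos a)"
      by (simp only: cmod_one_add_exp_cis cmod_one_diff_exp_cis)
    then have "cos a * (2 * exp X * (1 + (exp Y)\<^sup>2)) = (exp Y)\<^sup>2 * (1 + (exp X)\<^sup>2) - (1 + (exp X)\<^sup>2)"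
      by (simp add: algebra_simps)
    moreover have "2 * exp X * (1 + (exp Y)\<^sup>2) \<noteq> 0"
      by (smt (verit) exp_gt_zero mult_eq_0_iff zero_le_power2)
    ultimately show "cos a = ((exp Y)\<^sup>2 * (1 + (exp X)\<^sup>2) - (1 + (exp X)\<^sup>2))
      / (2 * exp X * (1 + (exp Y)\<^sup>2))"
      by (simp add: eq_divide_eq)
  qed
  then have "finite N"
    using finite_cos_eq finite_subset by blast
  then have AE_N: "AE a in lborel. a \<notin> N"
    by (intro AE_not_in countable_imp_null_set_lborel countable_finite)
  have inner: "continuous_on {0..2 * pi} (f a)"
    "(f a has_integral 2 * pi * ronkin_fiber X Y a) {0..2 * pi}" if "a \<in> {0..2 * pi}" "a \<notin> N" for a
  proof -
    have ne: "cmod (1 + of_real (exp X) * cis a)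
        \<noteq> cmod (of_real (exp Y) * (1 - of_real (exp X) * cis a))"
      using that by (simp add: N_def norm_mult)
    show "(f a has_integral 2 * pi * ronkin_fiber X Y a) {0..2 * pi}"
      using has_integral_ln_cmod_linear[OF ne]
      by (simp add: f_def[abs_def] P ronkin_fiber_def norm_mult)
    show "continuous_on {0..2 * pi} (f a)"
      unfolding f_def P using add_mult_cis_neq_0[OF ne] by (intro continuous_intros) auto
  qed
  have upper: "f a b \<le> ln C" for a b
  proof -
    have "cmod (domino_poly (of_real (exp X) * cis a) (of_real (exp Y) * cis b)) \<le> C"
      unfolding domino_poly_def C_def
      by (rule order_trans[OF norm_triangle_ineq4] add_mono order_trans[OF norm_triangle_ineq]
          | simp add: norm_mult)+
    \<comment> \<open>At a zero of the polynomial \<open>f\<close> takes the default value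
      \<open>ln 0 = 0\<close>, so the bound there asks for \<open>ln C\<close> to be
      nonnegative.\<close>
    moreover have "C \<ge> 1"
      by (simp add: C_def add_nonneg_nonneg)
    ultimately show ?thesis
      by (cases "domino_poly (of_real (exp X) * cis a) (of_real (exp Y) * cis b) = 0")
        (auto simp: f_def)
  qed
  have meas_f: "(\<lambda>p. f (fst p) (snd p)) \<in> borel_measurable (lborel \<Otimes>\<^sub>M lborel)"
  proof -
    have "(\<lambda>p. cmod (domino_poly (of_real (exp X) * cis (fst p)) (of_real (exp Y) * cis (snd p))))
        \<in> borel_measurable borel"
      unfolding domino_poly_def by (intro borel_measurable_continuous_onI continuous_intros)
    then have "(\<lambda>p. f (fst p) (snd p)) \<in> borel_measurable borel"
      unfolding f_def by (rule measurable_compose) simp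
    then show ?thesis by (simp add: lborel_prod)
  qed
  have meas_I: "(\<lambda>p. I (fst p) * I (snd p)) \<in> borel_measurable (lborel \<Otimes>\<^sub>M lborel)"
    unfolding I_def by measurable
  define g where "g = (\<lambda>(a, b). I a * I b * (ln C - f a b))"
  have meas_g: "g \<in> borel_measurable (lborel \<Otimes>\<^sub>M lborel)"
    unfolding g_def case_prod_beta using meas_f meas_I by measurable
  have g_eq: "g (a, b) = I a * (indicator {0..2 * pi} b *\<^sub>R (ln C - f a b))" for a b
    by (simp add: g_def I_def)
  have g_nonneg: "g p \<ge> 0" for p
    using upper by (cases p) (simp add: g_def I_def)
  have g_int: "integrable lborel (\<lambda>b. g (a, b))"
    and g_val: "(\<integral>b. g (a, b) \<partial>lborel) = indicator {0..2 * pi} a *\<^sub>R (2 * pi * ln C - 2 * pi * ronkin_fiber X Y a)"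
    if "a \<notin> N" for a
  proof -
    have "integrable lborel (\<lambda>b. g (a, b)) \<and> (\<integral>b. g (a, b) \<partial>lborel)
        = indicator {0..2 * pi} a *\<^sub>R (2 * pi * ln C - 2 * pi * ronkin_fiber X Y a)"
    proof (cases "a \<in> {0..2 * pi}")
      case True
      note in_a = inner[OF True that]
      have c: "continuous_on {0..2 * pi} (\<lambda>b. ln C - f a b)"
        by (intro continuous_intros in_a)
      have "((\<lambda>b. ln C - f a b) has_integral 2 * pi * ln C - 2 * pi * ronkin_fiber X Y a) {0..2 * pi}"
        using has_integral_diff[OF has_integral_const_real[of "ln C" 0 "2 * pi"] in_a(2)] by simp
      from set_lebesgue_integral_eq_has_integral[OF c this] borel_integrable_atLeastAtMost'[OF c] True
      show ?thesis
        unfolding g_eq set_lebesgue_integral_def set_integrable_def by (simp add: I_def)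
    qed (simp add: g_eq I_def)
    then show "integrable lborel (\<lambda>b. g (a, b))"
      and "(\<integral>b. g (a, b) \<partial>lborel) = indicator {0..2 * pi} a *\<^sub>R (2 * pi * ln C - 2 * pi * ronkin_fiber X Y a)"
      by auto
  qed
  have cont_outer: "continuous_on {0..2 * pi} (\<lambda>a. 2 * pi * ln C - 2 * pi * ronkin_fiber X Y a)"
    by (intro continuous_intros continuous_on_ronkin_fiber)
  have outer_int: "integrable lborel
      (\<lambda>a. indicator {0..2 * pi} a *\<^sub>R (2 * pi * ln C - 2 * pi * ronkin_fiber X Y a))"
    using borel_integrable_atLeastAtMost'[OF cont_outer] by (simp add: set_integrable_def)
  have meas_inner: "(\<lambda>a. \<integral>b. g (a, b) \<partial>lborel) \<in> borel_measurable lborel"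
    using meas_g by (intro lborel.borel_measurable_lebesgue_integral) simp
  have AE_inner: "AE a in lborel. (\<integral>b. g (a, b) \<partial>lborel)
      = indicator {0..2 * pi} a *\<^sub>R (2 * pi * ln C - 2 * pi * ronkin_fiber X Y a)"
    using AE_N by eventually_elim (rule g_val)
  have "integrable (lborel \<Otimes>\<^sub>M lborel) g"
  proof (rule lborel_pair.Fubini_integrable[OF meas_g])
    show "AE a in lborel. integrable lborel (\<lambda>b. g (a, b))"
      using AE_N by eventually_elim (rule g_int)
    have "integrable lborel (\<lambda>a. \<integral>b. g (a, b) \<partial>lborel)"
      using outer_int AE_inner by (subst integrable_cong_AE[OF meas_inner _ AE_inner]) auto
    then show "integrable lborel (\<lambda>a. \<integral>b. norm (g (a, b)) \<partial>lborel)"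
      using g_nonneg by simp
  qed
  note g_integrable = this
  have fin: "integrable (lborel \<Otimes>\<^sub>M lborel) (\<lambda>p. indicator ({0..2 * pi} \<times> {0..2 * pi}) p *\<^sub>R ln C)"
    unfolding lborel_prod
    using borel_integrable_compact[of "{0..2 * pi} \<times> {0..2 * pi}" "\<lambda>_::real\<times>real. ln C"]
    by (simp add: compact_Times continuous_on_const indicator_def if_distrib cong: if_cong)
  have "(\<integral>p. g p \<partial>(lborel \<Otimes>\<^sub>M lborel)) = (\<integral>a. \<integral>b. g (a, b) \<partial>lborel \<partial>lborel)"
    using lborel_pair.integral_fst'[OF g_integrable] by simp
  also have "\<dots> = (LINT a : {0..2 * pi} | lborel. 2 * pi * ln C - 2 * pi * ronkin_fiber X Y a)"
    unfolding set_lebesgue_integral_def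
    using AE_inner meas_inner outer_int by (intro integral_cong_AE) auto
  also have "\<dots> = (2 * pi)\<^sup>2 * ln C - 2 * pi * integral {0..2 * pi} (ronkin_fiber X Y)"
  proof (rule set_lebesgue_integral_eq_has_integral[OF cont_outer])
    have "(ronkin_fiber X Y has_integral integral {0..2 * pi} (ronkin_fiber X Y)) {0..2 * pi}"
      by (intro integrable_integral integrable_continuous_interval continuous_on_ronkin_fiber)
    from has_integral_diff[OF has_integral_const_real[of "2 * pi * ln C" 0 "2 * pi"]
        has_integral_mult_right[OF this, of "2 * pi"]]
    show "((\<lambda>a. 2 * pi * ln C - 2 * pi * ronkin_fiber X Y a) has_integral
      (2 * pi)\<^sup>2 * ln C - 2 * pi * integral {0..2 * pi} (ronkin_fiber X Y)) {0..2 * pi}"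
      by (simp add: power2_eq_square mult_ac)
  qed
  finally have g_total: "(\<integral>p. g p \<partial>(lborel \<Otimes>\<^sub>M lborel))
      = (2 * pi)\<^sup>2 * ln C - 2 * pi * integral {0..2 * pi} (ronkin_fiber X Y)" .
  have const: "(\<integral>p. indicator ({0..2 * pi} \<times> {0..2 * pi}) p *\<^sub>R ln C \<partial>(lborel \<Otimes>\<^sub>M lborel))
      = (2 * pi)\<^sup>2 * ln C"
  proof -
    have "{0..2 * pi} \<times> {0..2 * pi} = cbox (0, 0) (2 * pi, 2 * pi)"
      by (auto simp: cbox_Pair_eq)
    then show ?thesis
      unfolding lborel_prod
      by (simp add: content_Pair power2_eq_square)
  qed
  have "(LINT (a, b) : {0..2 * pi} \<times> {0..2 * pi} | lborel. f a b)
      = (\<integral>p. indicator ({0..2 * pi} \<times> {0..2 * pi}) p *\<^sub>R ln C - g p \<partial>(lborel \<Otimes>\<^sub>M lborel))"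
    unfolding set_lebesgue_integral_def lborel_prod
    by (intro Bochner_Integration.integral_cong)
      (auto simp: g_def I_def indicator_def algebra_simps)
  also have "\<dots> = 2 * pi * integral {0..2 * pi} (ronkin_fiber X Y)"
    using fin g_integrable g_total const by simp
  finally show ?thesis
    by (simp add: ronkin_def f_def power2_eq_square)
qed

text \<open>Conjugating z sends the angle a to 2 pi - a and preserves both moduli. On the half
  period the cosine is strictly decreasing, so the two branches cross at most once, which allows the
  integral to be cut at one angle.\<close>

lemma ronkin_eq_half_period:
  "ronkin X Y = 1 / pi * integral {0..pi} (ronkin_fiber X Y)"
proof -
  let ?f = "ronkin_fiber X Y"
  have sym: "?f (2 * pi + - x) = ?f x" for x
  proof -
    have c: "cis (2 * pi - x) = cnj (cis x)"
      by (simp add: complex_eq_iff sin_diff cos_diff)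
    have "cmod (1 + of_real (exp X) * cis (2 * pi - x)) = cmod (cnj (1 + of_real (exp X) * cis x))"
      by (simp only: c complex_cnj_add complex_cnj_diff complex_cnj_mult complex_cnj_one complex_cnj_complex_of_real)
    moreover have "cmod (1 - of_real (exp X) * cis (2 * pi - x)) = cmod (cnj (1 - of_real (exp X) * cis x))"
      by (simp only: c complex_cnj_add complex_cnj_diff complex_cnj_mult complex_cnj_one complex_cnj_complex_of_real)
    ultimately show ?thesis
      by (simp add: ronkin_fiber_def del: complex_cnj_add complex_cnj_diff complex_cnj_mult)
  qed
  have "integral {pi..2 * pi} ?f = integral {- pi + 2 * pi..0 + 2 * pi} ?f"
    by simp
  also have "\<dots> = integral {- pi..0} (?f \<circ> (\<lambda>x. x + 2 * pi))"
    by (rule integral_shift[symmetric]) (rule continuous_on_ronkin_fiber)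
  also have "\<dots> = integral {- pi..- 0} (\<lambda>x. ?f (- x))"
    using sym[of "- x" for x] by (simp add: o_def add.commute)
  also have "\<dots> = integral {0..pi} ?f"
    by (rule Henstock_Kurzweil_Integration.integral_reflect_real)
  finally have "integral {pi..2 * pi} ?f = integral {0..pi} ?f" .
  moreover have "integral {0..pi} ?f + integral {pi..2 * pi} ?f = integral {0..2 * pi} ?f"
    by (rule Henstock_Kurzweil_Integration.integral_combine)
      (auto intro!: integrable_continuous_interval continuous_on_ronkin_fiber)
  ultimately have "integral {0..2 * pi} ?f = 2 * integral {0..pi} ?f"
    by simp
  then show ?thesis
    by (simp add: ronkin_eq_integral_fiber)
qed

subsection \<open>The Legendre transform of the Ronkin function\<close>

text \<open>One function serves both branches, because the reflection a -> pi - a turns |1 - z| into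
  |1 + z|. It is used for \<beta> < pi, away from the zero of 1 + z at z = -1.\<close>

definition arc_integral :: "real \<Rightarrow> real \<Rightarrow> real" where
  "arc_integral \<beta> X = integral {0..\<beta>} (\<lambda>a. ln (cmod (1 + of_real (exp X) * cis a)))"

lemma cos_gt_minus_one:
  assumes "0 \<le> a" "a < pi"
  shows "cos a > - 1"
  using cos_monotone_0_pi[of a pi] assms by simp

lemma one_add_exp_cis_neq_0:
  assumes "0 \<le> a" "a < pi"
  shows "1 + of_real (exp X) * cis a \<noteq> 0"
proof -
  have "2 * exp X * (1 + cos a) > 0"
    using cos_gt_minus_one[OF assms] by simp
  then have "(cmod (1 + of_real (exp X) * cis a))\<^sup>2 > 0"
    unfolding cmod_one_add_exp_cis
    using zero_le_power2[of "1 - exp X"] by (simp add: power2_eq_square algebra_simps)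
  then show ?thesis
    by auto
qed

lemma one_add_exp_sq_pos:
  fixes X :: real
  assumes "0 \<le> a" "a < pi"
  shows "1 + (exp X)\<^sup>2 + 2 * exp X * cos a > 0"
  using one_add_exp_cis_neq_0[OF assms] by (simp flip: cmod_one_add_exp_cis)

lemma integrable_on_arc:
  assumes "\<beta> < pi"
  shows "(\<lambda>a. ln (cmod (1 + of_real (exp X) * cis a))) integrable_on {0..\<beta>}"
  using one_add_exp_cis_neq_0 assms
  by (intro integrable_continuous_interval continuous_intros) auto

text \<open>With r = exp X the fraction is the X-derivative of ln |1 + exp X cis a|. It equals 1/2 +
  (r^2 - 1) / (2 (1 + r^2 + 2 r cos a)), and the substitution tan (a/2) integrates the second term
  to the arctangent.\<close>

lemma has_real_derivative_arctan_mult_tan_half: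
  fixes r :: real
  assumes "0 \<le> a" "a < pi" "r > 0"
  shows "((\<lambda>a. a / 2 + arctan ((r - 1) / (r + 1) * tan (a / 2))) has_real_derivative
    (r\<^sup>2 + r * cos a) / (1 + r\<^sup>2 + 2 * r * cos a)) (at a)"
proof -
  define c d k where "c = cos (a / 2)" and "d = sin (a / 2)" and "k = (r - 1) / (r + 1)"
  have c: "c > 0"
    unfolding c_def using assms by (intro cos_gt_zero_pi) auto
  have dd: "d\<^sup>2 = 1 - c\<^sup>2"
    by (simp add: c_def d_def sin_squared_eq)
  have cos_a: "cos a = 2 * c\<^sup>2 - 1"
    using cos_double_cos[of "a / 2"] by (simp add: c_def)
  have tan_eq: "tan (a / 2) = d / c"
    by (simp add: tan_def c_def d_def)
  have pos: "1 + r\<^sup>2 + 2 * r * cos a > 0"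
    using one_add_exp_sq_pos[OF assms(1,2), of "ln r"] assms(3) by simp
  have "((\<lambda>a. a / 2 + arctan (k * tan (a / 2))) has_real_derivative
      1 / 2 + inverse (1 + (k * (d / c))\<^sup>2) * (k * (inverse (c\<^sup>2) * (1 / 2)))) (at a)"
    using c by (auto intro!: derivative_eq_intros simp: tan_eq simp flip: c_def)
  moreover have "1 / 2 + inverse (1 + (k * (d / c))\<^sup>2) * (k * (inverse (c\<^sup>2) * (1 / 2)))
      = (r\<^sup>2 + r * cos a) / (1 + r\<^sup>2 + 2 * r * cos a)"
  proof -
    have "1 + (k * (d / c))\<^sup>2 = ((r + 1)\<^sup>2 * c\<^sup>2 + (r - 1)\<^sup>2 * d\<^sup>2) / ((r + 1)\<^sup>2 * c\<^sup>2)"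
      using c assms(3) by (simp add: k_def power_mult_distrib power_divide add_divide_distrib)
    also have "(r + 1)\<^sup>2 * c\<^sup>2 + (r - 1)\<^sup>2 * d\<^sup>2 = 1 + r\<^sup>2 + 2 * r * cos a"
      unfolding dd cos_a by (simp add: power2_eq_square algebra_simps)
    finally have "inverse (1 + (k * (d / c))\<^sup>2) * (k * (inverse (c\<^sup>2) * (1 / 2)))
        = (r + 1)\<^sup>2 * c\<^sup>2 / (1 + r\<^sup>2 + 2 * r * cos a) * (k * (inverse (c\<^sup>2) * (1 / 2)))"
      by simp
    also have "\<dots> = (r\<^sup>2 - 1) / (2 * (1 + r\<^sup>2 + 2 * r * cos a))"
    proof -
      have "k * (r + 1) = r - 1"
        using assms(3) by (simp add: k_def)
      then have "(r + 1)\<^sup>2 * k = (r + 1) * (r - 1)"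
        by (metis mult.assoc mult.commute power2_eq_square)
      then have "(r + 1)\<^sup>2 * k = r\<^sup>2 - 1"
        by (simp add: power2_eq_square algebra_simps)
      moreover have "(r + 1)\<^sup>2 * c\<^sup>2 / D * (k * (inverse (c\<^sup>2) * (1 / 2))) = (r + 1)\<^sup>2 * k / (2 * D)" for D
        using c by (cases "D = 0") (simp_all add: field_simps)
      ultimately show ?thesis
        by metis
    qed
    finally show ?thesis
      using pos by (simp add: field_simps power2_eq_square)
  qed
  ultimately show ?thesis
    by (simp add: k_def)
qed

text \<open>Differentiation under the integral sign. The value is the argument of 1 + exp X cis
  \<beta>, as the Cauchy-Riemann equations predict: the X-derivative of the real part of the
  logarithm is the angular derivative of its imaginary part.\<close>

lemma has_real_derivative_arc_integral:
  assumes \<beta>: "0 \<le> \<beta>" "\<beta> < pi"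
  shows "(arc_integral \<beta> has_real_derivative
    \<beta> / 2 + arctan ((exp X - 1) / (exp X + 1) * tan (\<beta> / 2))) (at X)"
proof -
  define f' where "f' X a = ((exp X)\<^sup>2 + exp X * cos a) / (1 + (exp X)\<^sup>2 + 2 * exp X * cos a)"
    for X a :: real
  have pos: "1 + (exp x)\<^sup>2 + 2 * exp x * cos a > 0" if "a \<in> cbox 0 \<beta>" for x a :: real
    using that \<beta> by (intro one_add_exp_sq_pos) auto
  have ln_eq: "ln (cmod (1 + of_real (exp x) * cis a)) = ln (1 + (exp x)\<^sup>2 + 2 * exp x * cos a) / 2"
    for x a
    unfolding cmod_one_add_exp_cis[symmetric]
    by (cases "1 + of_real (exp x) * cis a = 0") (auto simp: ln_realpow)
  have "((\<lambda>x. integral (cbox 0 \<beta>) (\<lambda>a. ln (cmod (1 + of_real (exp x) * cis a)))) has_field_derivative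
      integral (cbox 0 \<beta>) (f' X)) (at X within UNIV)"
  proof (rule leibniz_rule_field_derivative)
    show "((\<lambda>x. ln (cmod (1 + of_real (exp x) * cis a))) has_field_derivative f' x a) (at x within UNIV)"
      if "a \<in> cbox 0 \<beta>" for x a
      unfolding ln_eq f'_def using pos[OF that, of x]
      by (auto intro!: derivative_eq_intros simp: field_simps power2_eq_square)
    show "(\<lambda>a. ln (cmod (1 + of_real (exp x) * cis a))) integrable_on cbox 0 \<beta>" for x
      using integrable_on_arc[OF \<beta>(2)] by simp
    show "continuous_on (UNIV \<times> cbox 0 \<beta>) (\<lambda>(x, a). f' x a)"
      unfolding f'_def case_prod_beta using pos
      by (intro continuous_intros) (auto simp: less_imp_neq[symmetric])
  qed auto
  moreover have "integral (cbox 0 \<beta>) (f' X)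
      = \<beta> / 2 + arctan ((exp X - 1) / (exp X + 1) * tan (\<beta> / 2))"
  proof -
    have "(f' X has_integral (\<beta> / 2 + arctan ((exp X - 1) / (exp X + 1) * tan (\<beta> / 2)))
        - (0 / 2 + arctan ((exp X - 1) / (exp X + 1) * tan (0 / 2)))) {0..\<beta>}"
    proof (rule fundamental_theorem_of_calculus[OF \<beta>(1)])
      fix a assume "a \<in> {0..\<beta>}"
      then have "((\<lambda>a. a / 2 + arctan ((exp X - 1) / (exp X + 1) * tan (a / 2))) has_real_derivative f' X a) (at a)"
        unfolding f'_def using \<beta> by (intro has_real_derivative_arctan_mult_tan_half) auto
      then show "((\<lambda>a. a / 2 + arctan ((exp X - 1) / (exp X + 1) * tan (a / 2))) has_vector_derivative f' X a)
          (at a within {0..\<beta>})"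
        by (metis has_real_derivative_iff_has_vector_derivative has_vector_derivative_at_within)
    qed
    then show ?thesis
      by (simp add: integral_unique)
  qed
  ultimately show ?thesis
    by (simp add: arc_integral_def[abs_def])
qed

text \<open>The quotient (exp x - 1) / (exp x + 1) is tanh (x/2), which increases in x, and its
  factor tan (\<beta>/2) is nonnegative; so the derivative is monotone.\<close>

lemma convex_on_arc_integral:
  assumes "0 \<le> \<beta>" "\<beta> < pi"
  shows "convex_on UNIV (arc_integral \<beta>)"
proof (rule convex_on_realI[OF _ has_real_derivative_arc_integral[OF assms]])
  fix x y :: real assume "x \<le> y"
  then have "(exp x - 1) / (exp x + 1) \<le> (exp y - 1) / (exp y + 1)"
    using add_pos_pos[OF exp_gt_zero zero_less_one, of x] add_pos_pos[OF exp_gt_zero zero_less_one, of y]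
    by (simp add: field_simps)
  moreover have "tan (\<beta> / 2) \<ge> 0"
    using assms by (intro tan_pos_pi2_le) auto
  ultimately show "\<beta> / 2 + arctan ((exp x - 1) / (exp x + 1) * tan (\<beta> / 2))
      \<le> \<beta> / 2 + arctan ((exp y - 1) / (exp y + 1) * tan (\<beta> / 2))"
    by (intro add_left_mono arctan_monotone' mult_right_mono)
qed auto

text \<open>The condition is on the product because the intended arguments are T tan (\<alpha>/2)
  and T cot (\<alpha>/2) with T^2 < 1, of which one may be large. It makes cos (A + B) positive, and
  since |A + B| < pi this forces |A + B| < pi/2, where \<open>arctan\<close> inverts
  \<open>tan\<close>.\<close>

lemma arctan_add_if_mult_less_one:
  assumes "x * y < 1"
  shows "arctan x + arctan y = arctan ((x + y) / (1 - x * y))"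
proof -
  define A B where "A = arctan x" and "B = arctan y"
  have AB: "- (pi / 2) < A" "A < pi / 2" "- (pi / 2) < B" "B < pi / 2"
    using arctan_bounded by (auto simp: A_def B_def)
  have cos_pos: "cos A > 0" "cos B > 0"
    using AB by (auto intro: cos_gt_zero_pi)
  have xy: "x = tan A" "y = tan B"
    by (simp_all add: A_def B_def tan_arctan)
  have "cos (A + B) = cos A * cos B * (1 - x * y)"
    using cos_pos by (simp add: cos_add xy tan_def field_simps)
  then have pos: "cos (A + B) > 0"
    using cos_pos assms by simp
  have "\<bar>A + B\<bar> < pi / 2"
  proof (rule ccontr)
    assume "\<not> ?thesis"
    then have "pi / 2 \<le> \<bar>A + B\<bar>" "\<bar>A + B\<bar> \<le> pi"
      using AB by auto
    then have "cos \<bar>A + B\<bar> \<le> cos (pi / 2)"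
      by (intro cos_monotone_0_pi_le) auto
    with pos show False by simp
  qed
  then have "A + B = arctan (tan (A + B))"
    unfolding abs_less_iff by (intro arctan_tan[symmetric]) linarith+
  also have "tan (A + B) = (x + y) / (1 - x * y)"
    unfolding xy using cos_pos pos by (intro tan_add) auto
  finally show ?thesis
    by (simp add: A_def B_def)
qed

text \<open>With T = tanh (X/2), the addition formula combines T / (1 - T^2) = sinh X / 2 with tan
  (\<alpha>/2) + cot (\<alpha>/2) = 2 / sin \<alpha>. The left side is the nonlinear part of the
  derivatives of the two arc integrals on either side of a cut.\<close>

lemma arctan_half_angle_sum:
  fixes X \<alpha> :: real
  assumes "0 < \<alpha>" "\<alpha> < pi"
  shows "arctan ((exp X - 1) / (exp X + 1) * tan (\<alpha> / 2))
      + arctan ((exp X - 1) / (exp X + 1) * tan ((pi - \<alpha>) / 2)) = arctan (sinh X / sin \<alpha>)"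
proof -
  define T where "T = (exp X - 1) / (exp X + 1)"
  define c d where "c = cos (\<alpha> / 2)" and "d = sin (\<alpha> / 2)"
  have cd: "c > 0" "d > 0"
    unfolding c_def d_def using assms by (auto intro: cos_gt_zero_pi sin_gt_zero)
  have tans: "tan (\<alpha> / 2) = d / c" "tan ((pi - \<alpha>) / 2) = c / d"
    by (auto simp: tan_def c_def d_def diff_divide_distrib sin_diff cos_diff)
  have sin_eq: "sin \<alpha> = 2 * d * c"
    using sin_double[of "\<alpha> / 2"] by (simp add: c_def d_def)
  have dd: "c\<^sup>2 + d\<^sup>2 = 1"
    by (simp add: c_def d_def)
  have r1: "exp X + 1 > 0"
    by (simp add: add_pos_pos)
  have T2: "1 - T * T = 4 * exp X / (exp X + 1)\<^sup>2"
  proof -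
    have "T * (exp X + 1) = exp X - 1"
      using r1 by (simp add: T_def)
    note T = this
    have "(1 - T * T) * (exp X + 1)\<^sup>2 = (exp X + 1)\<^sup>2 - (T * (exp X + 1))\<^sup>2"
      by (simp add: power2_eq_square algebra_simps)
    also have "\<dots> = 4 * exp X"
      unfolding T by (simp add: power2_eq_square algebra_simps)
    finally have "(1 - T * T) * (exp X + 1)\<^sup>2 = 4 * exp X" .
    then show ?thesis
      using r1 by (simp add: eq_divide_eq)
  qed
  then have "T * T < 1"
    using r1 by (smt (verit) divide_pos_pos exp_gt_zero zero_less_power)
  moreover have "T * (d / c) * (T * (c / d)) = T * T"
    using cd by simp
  ultimately have "arctan (T * (d / c)) + arctan (T * (c / d))
      = arctan ((T * (d / c) + T * (c / d)) / (1 - T * T))"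
    using arctan_add_if_mult_less_one[of "T * (d / c)" "T * (c / d)"] by simp
  also have "T * (d / c) + T * (c / d) = T * (c\<^sup>2 + d\<^sup>2) / (c * d)"
    using cd by (simp add: field_simps power2_eq_square)
  also have "\<dots> / (1 - T * T) = sinh X / sin \<alpha>"
  proof -
    have "T / (1 - T * T) = sinh X / 2"
    proof -
      have "T * (exp X + 1)\<^sup>2 = (exp X - 1) * (exp X + 1)"
        using r1 by (simp add: T_def power2_eq_square)
      then have "T / (1 - T * T) = (exp X - 1) * (exp X + 1) / (4 * exp X)"
        unfolding T2 by simp
      also have "\<dots> = sinh X / 2"
        by (simp add: sinh_field_def exp_minus field_simps)
      finally show ?thesis .
    qed
    note T = this
    have "T * (c\<^sup>2 + d\<^sup>2) / (c * d) / (1 - T * T) = T / (1 - T * T) / (c * d)"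
      unfolding dd by (simp add: mult.commute)
    then show ?thesis
      unfolding T by (simp add: sin_eq mult_ac)
  qed
  finally show ?thesis
    unfolding tans T_def .
qed

section \<open>Cutting the half period between the two branches\<close>

lemma cmod_one_diff_cis_reflect:
  "cmod (1 - of_real r * cis a) = cmod (1 + of_real r * cis (pi - a))"
proof -
  have "1 + of_real r * cis (pi - a) = cnj (1 - of_real r * cis a)"
    by (simp add: complex_eq_iff sin_diff cos_diff)
  then show ?thesis
    by (metis complex_mod_cnj)
qed

lemma has_integral_ln_cmod_one_diff:
  assumes "0 < \<alpha>"
  shows "((\<lambda>a. ln (cmod (1 - of_real (exp X) * cis a))) has_integral arc_integral (pi - \<alpha>) X)
    {\<alpha>..pi}"
proof -
  define f where "f a = ln (cmod (1 + of_real (exp X) * cis a))" for a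
  have "f integrable_on {0..pi - \<alpha>}"
    unfolding f_def using integrable_on_arc assms by simp
  then have "(f has_integral arc_integral (pi - \<alpha>) X) (cbox 0 (pi - \<alpha>))"
    by (auto simp: arc_integral_def f_def[abs_def] intro: integrable_integral)
  from has_integral_affinity[OF this, of "- 1" pi]
  have "((\<lambda>a. f (pi - a)) has_integral arc_integral (pi - \<alpha>) X)
      ((\<lambda>x. pi - x) ` {0..pi - \<alpha>})"
    by (simp add: cbox_interval)
  moreover have "(\<lambda>x. pi - x) ` {0..pi - \<alpha>} = {\<alpha>..pi}"
    by (simp add: image_diff_atLeastAtMost)
  ultimately show ?thesis
    by (simp add: f_def cmod_one_diff_cis_reflect)
qed

lemma has_integral_arc_integral:
  assumes "\<alpha> < pi"
  shows "((\<lambda>a. ln (cmod (1 + of_real (exp X) * cis a))) has_integral arc_integral \<alpha> X) {0..\<alpha>}"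
  using integrable_on_arc[OF assms] by (simp add: arc_integral_def integrable_integral)

text \<open>Each range omits the one endpoint where its branch can vanish: there the default
  \<open>ln 0 = 0\<close> may exceed the fiber value.\<close>

lemma ronkin_fiber_ge:
  shows "0 \<le> a \<Longrightarrow> a < pi \<Longrightarrow> ln (cmod (1 + of_real (exp X) * cis a)) \<le> ronkin_fiber X Y a"
    and "0 < a \<Longrightarrow> a \<le> pi \<Longrightarrow> Y + ln (cmod (1 - of_real (exp X) * cis a)) \<le> ronkin_fiber X Y a"
proof -
  assume "0 \<le> a" "a < pi"
  then have "1 + of_real (exp X) * cis a \<noteq> 0"
    by (rule one_add_exp_cis_neq_0)
  then show "ln (cmod (1 + of_real (exp X) * cis a)) \<le> ronkin_fiber X Y a"
    unfolding ronkin_fiber_def by (intro ln_mono ronkin_fiber_arg_pos) auto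
next
  assume "0 < a" "a \<le> pi"
  then have "1 + of_real (exp X) * cis (pi - a) \<noteq> 0"
    by (intro one_add_exp_cis_neq_0) auto
  then have "cmod (1 - of_real (exp X) * cis a) > 0"
    by (simp add: cmod_one_diff_cis_reflect)
  then have "Y + ln (cmod (1 - of_real (exp X) * cis a)) = ln (exp Y * cmod (1 - of_real (exp X) * cis a))"
    by (simp add: ln_mult)
  also have "\<dots> \<le> ronkin_fiber X Y a"
    unfolding ronkin_fiber_def using \<open>cmod (1 - of_real (exp X) * cis a) > 0\<close>
    by (intro ln_mono ronkin_fiber_arg_pos) auto
  finally show "Y + ln (cmod (1 - of_real (exp X) * cis a)) \<le> ronkin_fiber X Y a" .
qed

text \<open>The difference of the squared moduli is affine in \<open>cos a\<close> with positive
  slope, and the third hypothesis places its zero at \<open>cos \<alpha>\<close>. As the cosine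
  decreases on [0, pi], the first branch wins before \<alpha> and the second after it.\<close>

lemma ronkin_fiber_branch:
  assumes "0 < \<alpha>" "\<alpha> < pi" "cos \<alpha> = cosh X * tanh Y"
  shows "0 \<le> a \<Longrightarrow> a \<le> \<alpha> \<Longrightarrow> ronkin_fiber X Y a = ln (cmod (1 + of_real (exp X) * cis a))"
    and "\<alpha> \<le> a \<Longrightarrow> a \<le> pi \<Longrightarrow> ronkin_fiber X Y a = Y + ln (cmod (1 - of_real (exp X) * cis a))"
proof -
  have key: "(cmod (1 + of_real (exp X) * cis a))\<^sup>2 - (exp Y * cmod (1 - of_real (exp X) * cis a))\<^sup>2
      = 4 * exp X * exp Y * cosh Y * (cos a - cos \<alpha>)" for a
  proof -
    have "cosh Y * cos \<alpha> = cosh X * sinh Y"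
      using assms(3) by (simp add: tanh_def)
    then have "4 * exp X * exp Y * cosh Y * (cos a - cos \<alpha>)
        = 4 * exp X * exp Y * (cosh Y * cos a - cosh X * sinh Y)"
      by (simp add: algebra_simps)
    also have "\<dots> = 1 + (exp X)\<^sup>2 + 2 * exp X * cos a - (exp Y)\<^sup>2 * (1 + (exp X)\<^sup>2 - 2 * exp X * cos a)"
      by (simp add: cosh_field_def sinh_field_def exp_minus field_simps power2_eq_square)
    finally show ?thesis
      unfolding power_mult_distrib cmod_one_add_exp_cis cmod_one_diff_exp_cis by simp
  qed
  show "ronkin_fiber X Y a = ln (cmod (1 + of_real (exp X) * cis a))" if "0 \<le> a" "a \<le> \<alpha>"
  proof -
    have "cos \<alpha> \<le> cos a"
      using that assms by (intro cos_monotone_0_pi_le) auto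
    then have "(exp Y * cmod (1 - of_real (exp X) * cis a))\<^sup>2 \<le> (cmod (1 + of_real (exp X) * cis a))\<^sup>2"
      using key[of a] by (smt (verit) cosh_real_pos exp_gt_zero mult_nonneg_nonneg)
    then have "exp Y * cmod (1 - of_real (exp X) * cis a) \<le> cmod (1 + of_real (exp X) * cis a)"
      by (rule power2_le_imp_le) simp
    then show ?thesis
      by (simp add: ronkin_fiber_def)
  qed
  show "ronkin_fiber X Y a = Y + ln (cmod (1 - of_real (exp X) * cis a))" if "\<alpha> \<le> a" "a \<le> pi"
  proof -
    have "cos a \<le> cos \<alpha>"
      using that assms by (intro cos_monotone_0_pi_le) auto
    then have "4 * exp X * exp Y * cosh Y * (cos a - cos \<alpha>) \<le> 0"
      by (intro mult_nonneg_nonpos) auto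
    then have "(cmod (1 + of_real (exp X) * cis a))\<^sup>2 \<le> (exp Y * cmod (1 - of_real (exp X) * cis a))\<^sup>2"
      using key[of a] by linarith
    then have "cmod (1 + of_real (exp X) * cis a) \<le> exp Y * cmod (1 - of_real (exp X) * cis a)"
      by (rule power2_le_imp_le) simp
    then have eq: "ronkin_fiber X Y a = ln (exp Y * cmod (1 - of_real (exp X) * cis a))"
      and "exp Y * cmod (1 - of_real (exp X) * cis a) > 0"
      using ronkin_fiber_arg_pos[of X a Y] by (simp_all add: ronkin_fiber_def max_def split: if_splits)
    then show ?thesis
      by (simp add: ln_mult zero_less_mult_iff)
  qed
qed

lemma has_integral_ronkin_fiber_split:
  assumes "0 < \<alpha>" "\<alpha> < pi"
  shows "((\<lambda>a. if a \<le> \<alpha> then ln (cmod (1 + of_real (exp X) * cis a))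
      else Y + ln (cmod (1 - of_real (exp X) * cis a))) has_integral
    (pi - \<alpha>) * Y + arc_integral \<alpha> X + arc_integral (pi - \<alpha>) X) {0..pi}"
proof -
  let ?g = "\<lambda>a. if a \<le> \<alpha> then ln (cmod (1 + of_real (exp X) * cis a))
      else Y + ln (cmod (1 - of_real (exp X) * cis a))"
  have "(?g has_integral arc_integral \<alpha> X) {0..\<alpha>}"
    by (rule has_integral_eq[OF _ has_integral_arc_integral[OF assms(2)]]) auto
  moreover have "(?g has_integral (pi - \<alpha>) * Y + arc_integral (pi - \<alpha>) X) {\<alpha>..pi}"
  proof (rule has_integral_spike_finite[of "{\<alpha>}"])
    show "((\<lambda>a. Y + ln (cmod (1 - of_real (exp X) * cis a))) has_integral
        (pi - \<alpha>) * Y + arc_integral (pi - \<alpha>) X) {\<alpha>..pi}"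
      using has_integral_add[OF has_integral_const_real[of Y \<alpha> pi]
          has_integral_ln_cmod_one_diff[OF assms(1)]] assms by simp
  qed auto
  ultimately show ?thesis
    using has_integral_combine[of 0 \<alpha> pi ?g] assms by (simp add: add_ac)
qed

text \<open>Integrating the maximum over the fiber dominates integrating either branch on either side of
  any cut \<open>\<alpha>\<close>, with equality for the cut where the branches cross. In this way a subgradient
  inequality in two variables reduces to convexity of \<^const>\<open>arc_integral\<close> in one.\<close>

lemma ronkin_lower_bound:
  assumes "0 < \<alpha>" "\<alpha> < pi"
  shows "(pi - \<alpha>) * Y + arc_integral \<alpha> X + arc_integral (pi - \<alpha>) X \<le> pi * ronkin X Y"
proof -
  have "(ronkin_fiber X Y has_integral integral {0..pi} (ronkin_fiber X Y)) {0..pi}"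
    by (intro integrable_integral integrable_continuous_interval continuous_on_ronkin_fiber)
  from has_integral_le[OF has_integral_ronkin_fiber_split[OF assms, of X Y] this]
  show ?thesis
    using assms ronkin_fiber_ge[where X = X and Y = Y] by (simp add: ronkin_eq_half_period)
qed

lemma ronkin_eq_arc_integral:
  assumes "0 < \<alpha>" "\<alpha> < pi" "cos \<alpha> = cosh X * tanh Y"
  shows "pi * ronkin X Y = (pi - \<alpha>) * Y + arc_integral \<alpha> X + arc_integral (pi - \<alpha>) X"
proof -
  have "(ronkin_fiber X Y has_integral
      (pi - \<alpha>) * Y + arc_integral \<alpha> X + arc_integral (pi - \<alpha>) X) {0..pi}"
    by (rule has_integral_eq[OF _ has_integral_ronkin_fiber_split[OF assms(1,2)]])
      (simp add: ronkin_fiber_branch[OF assms])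
  then show ?thesis
    by (simp add: ronkin_eq_half_period integral_unique)
qed

text \<open>The gradient of the surface tension at \<open>(s, t)\<close> is \<open>(dual_coord s t, dual_coord t s)\<close>.
  With the signs \<open>\<bar>z\<bar> = exp (- dual_coord s t)\<close> and \<open>\<bar>w\<bar> = exp (- dual_coord t s)\<close>, the points
  \<open>z = \<bar>z\<bar> cis (- \<pi> t)\<close> and \<open>w = \<bar>w\<bar> cis (\<pi> s)\<close> lie on the spectral curve.\<close>

definition dual_coord :: "real \<Rightarrow> real \<Rightarrow> real" where
  "dual_coord s t = - arsinh (cot (pi * s) * sin (pi * t))"

text \<open>The point is the symmetry of the right side in s and t: sin (pi s) cosh X = sin (pi t)
  cosh Y at the dual point. The same root reappears as \<open>D\<close> in the spectral curve
  computation.\<close>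

lemma cosh_dual_coord:
  assumes "0 < s" "s < 1" "0 < t" "t < 1"
  shows "sin (pi * s) * cosh (dual_coord s t) = sqrt (1 - (cos (pi * s) * cos (pi * t))\<^sup>2)"
proof (rule real_sqrt_unique[symmetric])
  have sin_s: "sin (pi * s) > 0"
    using assms by (intro sin_gt_zero) auto
  then show "0 \<le> sin (pi * s) * cosh (dual_coord s t)"
    by simp
  have "(cosh (dual_coord s t))\<^sup>2 = 1 + (cot (pi * s) * sin (pi * t))\<^sup>2"
    using cosh_square_eq[of "dual_coord s t"] by (simp add: dual_coord_def)
  then have "(sin (pi * s) * cosh (dual_coord s t))\<^sup>2
      = (sin (pi * s))\<^sup>2 + (cos (pi * s))\<^sup>2 * (sin (pi * t))\<^sup>2"
    using sin_s by (simp add: power_mult_distrib cot_def power_divide distrib_left)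
  then show "(sin (pi * s) * cosh (dual_coord s t))\<^sup>2 = 1 - (cos (pi * s) * cos (pi * t))\<^sup>2"
    by (simp add: sin_squared_eq power_mult_distrib algebra_simps)
qed

text \<open>This is the crossing condition for the cut \<alpha> = pi (1 - t). That cut is forced: Y
  enters only on the arc from \<alpha> to pi, whose share of the half period has to be the slope
  t.\<close>

lemma cos_eq_cosh_tanh_dual_coord:
  assumes "0 < s" "s < 1" "0 < t" "t < 1"
  shows "cos (pi * (1 - t)) = cosh (dual_coord s t) * tanh (dual_coord t s)"
proof -
  have sins: "sin (pi * s) > 0" "sin (pi * t) > 0"
    using assms by (auto intro!: sin_gt_zero)
  have "sin (pi * s) * cosh (dual_coord s t) = sin (pi * t) * cosh (dual_coord t s)"
    using cosh_dual_coord[of s t] cosh_dual_coord[of t s] assms by (simp add: mult.commute)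
  then have c: "cosh (dual_coord s t) = sin (pi * t) * cosh (dual_coord t s) / sin (pi * s)"
    using sins by (simp add: field_simps)
  have "cosh (dual_coord s t) * tanh (dual_coord t s)
      = sin (pi * t) * sinh (dual_coord t s) / sin (pi * s)"
    unfolding c tanh_def by simp
  also have "\<dots> = - cos (pi * t)"
    using sins by (simp add: dual_coord_def cot_def)
  finally show ?thesis
    by (simp add: right_diff_distrib cos_diff)
qed

text \<open>The cut is frozen at pi (1 - t) for all (X, Y). The resulting lower bound for pi times
  \<open>ronkin\<close> is linear in Y with slope pi t and convex in X, and it is exact at the dual
  point. Its X-derivative is pi/2 + arctan (sinh X / sin \<alpha>); solving for the value pi s is
  the origin of \<open>dual_coord\<close>.\<close>

lemma ronkin_subgradient:
  assumes "0 < s" "s < 1" "0 < t" "t < 1"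
  shows "ronkin (dual_coord s t) (dual_coord t s)
      + s * (X - dual_coord s t) + t * (Y - dual_coord t s) \<le> ronkin X Y"
proof -
  define X0 Y0 \<alpha> where "X0 = dual_coord s t" and "Y0 = dual_coord t s" and "\<alpha> = pi * (1 - t)"
  define G where "G X = arc_integral \<alpha> X + arc_integral (pi - \<alpha>) X" for X
  have \<alpha>: "0 < \<alpha>" "\<alpha> < pi"
    using assms by (auto simp: \<alpha>_def)
  have sin_\<alpha>: "sin \<alpha> = sin (pi * t)" "sin (pi * t) > 0"
    using assms by (auto simp: \<alpha>_def right_diff_distrib sin_diff intro!: sin_gt_zero)
  have "convex_on UNIV G"
    unfolding G_def[abs_def] using \<alpha> by (intro convex_on_add convex_on_arc_integral) auto
  moreover have "(G has_real_derivative pi * s) (at X0)"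
  proof -
    have "(G has_real_derivative \<alpha> / 2 + arctan ((exp X0 - 1) / (exp X0 + 1) * tan (\<alpha> / 2))
        + ((pi - \<alpha>) / 2 + arctan ((exp X0 - 1) / (exp X0 + 1) * tan ((pi - \<alpha>) / 2)))) (at X0)"
      unfolding G_def[abs_def] using \<alpha> by (intro DERIV_add has_real_derivative_arc_integral) auto
    moreover have "\<alpha> / 2 + arctan ((exp X0 - 1) / (exp X0 + 1) * tan (\<alpha> / 2))
        + ((pi - \<alpha>) / 2 + arctan ((exp X0 - 1) / (exp X0 + 1) * tan ((pi - \<alpha>) / 2)))
        = pi / 2 + arctan (sinh X0 / sin \<alpha>)"
      using arctan_half_angle_sum[OF \<alpha>, of X0] by (simp add: diff_divide_distrib)
    moreover have "sinh X0 / sin \<alpha> = tan (pi * s - pi / 2)"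
      using sin_\<alpha> by (simp add: X0_def dual_coord_def tan_def cot_def sin_diff cos_diff)
    moreover have "arctan (tan (pi * s - pi / 2)) = pi * s - pi / 2"
      using assms by (intro arctan_tan) auto
    ultimately show ?thesis
      by simp
  qed
  ultimately have "pi * s * (X - X0) \<le> G X - G X0"
    by (intro convex_on_imp_above_tangent[of UNIV]) auto
  moreover have "(pi - \<alpha>) * Y + G X \<le> pi * ronkin X Y"
    using ronkin_lower_bound[OF \<alpha>, of Y X] by (simp add: G_def)
  moreover have "pi * ronkin X0 Y0 = (pi - \<alpha>) * Y0 + G X0"
    unfolding G_def X0_def Y0_def
    using ronkin_eq_arc_integral[OF \<alpha> cos_eq_cosh_tanh_dual_coord[OF assms, folded \<alpha>_def]]
    by simp
  moreover have "pi - \<alpha> = pi * t"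
    by (simp add: \<alpha>_def algebra_simps)
  ultimately have "pi * (ronkin X0 Y0 + s * (X - X0) + t * (Y - Y0)) \<le> pi * ronkin X Y"
    by (simp add: algebra_simps)
  then show ?thesis
    by (simp add: X0_def Y0_def)
qed

text \<open>The subgradient inequality says that the dual point is a maximizer, so the
  \<open>SUP\<close> over the reals is an attained maximum. The second part is the Fenchel-Young
  inequality, later evaluated at the dual points of other slopes.\<close>

lemma surface_tension_legendre:
  assumes "0 < s" "s < 1" "0 < t" "t < 1"
  shows "surface_tension (s, t)
      = s * dual_coord s t + t * dual_coord t s - ronkin (dual_coord s t) (dual_coord t s)"
    and "s * X + t * Y - ronkin X Y \<le> surface_tension (s, t)"
proof -
  let ?f = "\<lambda>(X, Y). s * X + t * Y - ronkin X Y"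
  have le: "?f q \<le> ?f (dual_coord s t, dual_coord t s)" for q
    using ronkin_subgradient[OF assms, of "fst q" "snd q"]
    by (simp add: case_prod_beta algebra_simps)
  then show eq: "surface_tension (s, t)
      = s * dual_coord s t + t * dual_coord t s - ronkin (dual_coord s t) (dual_coord t s)"
    unfolding surface_tension_def by (simp, intro cSup_eq_maximum) auto
  show "s * X + t * Y - ronkin X Y \<le> surface_tension (s, t)"
    using le[of "(X, Y)"] by (simp add: eq)
qed

text \<open>A continuous choice of subgradients is the derivative: the inequality from u to v and
  the one from v to u trap the difference quotient between \<open>d u\<close> and
  \<open>d v\<close>.\<close>

lemma has_real_derivative_if_subgradient:
  fixes f d :: "real \<Rightarrow> real"
  assumes "open U" "u \<in> U" "isCont d u"
    and "\<And>v w. v \<in> U \<Longrightarrow> w \<in> U \<Longrightarrow> f v + (w - v) * d v \<le> f w"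
  shows "(f has_real_derivative d u) (at u)"
proof -
  have "((\<lambda>v. (f v - f u) / (v - u) - d u) \<longlongrightarrow> 0) (at u)"
  proof (rule Lim_null_comparison)
    show "((\<lambda>v. \<bar>d v - d u\<bar>) \<longlongrightarrow> 0) (at u)"
      using assms(3) unfolding isCont_def by (intro tendsto_rabs_zero LIM_zero)
    have "\<forall>\<^sub>F v in at u. v \<in> U \<and> v \<noteq> u"
      using eventually_at_in_open[OF assms(1,2)] by (auto elim: eventually_mono)
    then show "\<forall>\<^sub>F v in at u. norm ((f v - f u) / (v - u) - d u) \<le> \<bar>d v - d u\<bar>"
    proof eventually_elim
      case (elim v)
      have "0 \<le> (f v - f u) - (v - u) * d u" "(f v - f u) - (v - u) * d u \<le> (v - u) * (d v - d u)"
        using assms(4)[of u v] assms(4)[of v u] elim assms(2) by (auto simp: algebra_simps)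
      then have "\<bar>(f v - f u) - (v - u) * d u\<bar> \<le> \<bar>v - u\<bar> * \<bar>d v - d u\<bar>"
        by (simp flip: abs_mult)
      moreover have "(f v - f u) / (v - u) - d u = ((f v - f u) - (v - u) * d u) / (v - u)"
        using elim by (simp add: field_simps)
      ultimately show ?case
        using elim by (simp add: abs_divide divide_le_eq mult.commute)
    qed
  qed
  then show ?thesis
    by (simp add: has_field_derivative_iff LIM_zero_iff)
qed

section \<open>The gradient of the surface tension\<close>

lemma isCont_dual_coord:
  assumes "0 < s" "s < 1" "0 < t" "t < 1"
  shows "isCont (\<lambda>s. dual_coord s t) s" and "isCont (\<lambda>t. dual_coord s t) t"
proof -
  have "sin (pi * s) \<noteq> 0"
    using assms sin_gt_zero[of "pi * s"] by simp
  then show "isCont (\<lambda>s. dual_coord s t) s" and "isCont (\<lambda>t. dual_coord s t) t"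
    unfolding dual_coord_def cot_def by (auto intro!: continuous_intros)
qed

text \<open>Envelope argument: the maximizer for one slope is a competitor for any other, and
  subtracting the two Legendre expressions leaves the change of slope times a dual coordinate. So
  the dual coordinates are subgradients, and they depend continuously on the slope.\<close>

lemma partial_surface_tension:
  assumes "0 < s" "s < 1" "0 < t" "t < 1"
  shows "partial_x surface_tension (s, t) = dual_coord s t"
    and "partial_y surface_tension (s, t) = dual_coord t s"
proof -
  have "((\<lambda>u. surface_tension (u, t)) has_real_derivative dual_coord s t) (at s)"
  proof (rule has_real_derivative_if_subgradient[of "{0<..<1}"])
    fix v w :: real assume "v \<in> {0<..<1}" "w \<in> {0<..<1}"
    then show "surface_tension (v, t) + (w - v) * dual_coord v t \<le> surface_tension (w, t)"
      using surface_tension_legendre(1)[of v t] assms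
        surface_tension_legendre(2)[of w t "dual_coord v t" "dual_coord t v"]
      by (simp add: algebra_simps)
  qed (use assms isCont_dual_coord in auto)
  then show "partial_x surface_tension (s, t) = dual_coord s t"
    by (simp add: partial_x_def has_real_derivative_iff_has_vector_derivative vector_derivative_at)
  have "((\<lambda>u. surface_tension (s, u)) has_real_derivative dual_coord t s) (at t)"
  proof (rule has_real_derivative_if_subgradient[of "{0<..<1}"])
    fix v w :: real assume "v \<in> {0<..<1}" "w \<in> {0<..<1}"
    then show "surface_tension (s, v) + (w - v) * dual_coord v s \<le> surface_tension (s, w)"
      using surface_tension_legendre(1)[of s v] assms
        surface_tension_legendre(2)[of s w "dual_coord s v" "dual_coord v s"]
      by (simp add: algebra_simps)
  qed (use assms isCont_dual_coord in auto)
  then show "partial_y surface_tension (s, t) = dual_coord t s"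
    by (simp add: partial_y_def has_real_derivative_iff_has_vector_derivative vector_derivative_at)
qed

subsection \<open>Partial derivatives and the complex coordinates\<close>

lemma has_vector_derivative_partial_x:
  assumes "f differentiable (at (x, y))"
  shows "((\<lambda>u. f (u, y)) has_vector_derivative partial_x f (x, y)) (at x)"
proof -
  have "(\<lambda>u. f (u, y)) differentiable (at x)"
    by (rule differentiable_compose[of f]) (auto intro!: assms differentiable_Pair)
  then show ?thesis
    by (simp add: partial_x_def vector_derivative_works)
qed

lemma has_vector_derivative_partial_y:
  assumes "f differentiable (at (x, y))"
  shows "((\<lambda>v. f (x, v)) has_vector_derivative partial_y f (x, y)) (at y)"
proof -
  have "(\<lambda>v. f (x, v)) differentiable (at y)"
    by (rule differentiable_compose[of f]) (auto intro!: assms differentiable_Pair)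
  then show ?thesis
    by (simp add: partial_y_def vector_derivative_works)
qed

lemma partial_cong:
  assumes "open U" "p \<in> U" "\<And>q. q \<in> U \<Longrightarrow> f q = g q"
  shows "partial_x f p = partial_x g p" and "partial_y f p = partial_y g p"
proof -
  have "open ((\<lambda>u. (u, snd p)) -` U)" "open ((\<lambda>v. (fst p, v)) -` U)"
    by (intro open_vimage assms(1) continuous_intros)+
  from this[THEN eventually_nhds_in_open] assms(2)
  have "\<forall>\<^sub>F u in nhds (fst p). (u, snd p) \<in> U" "\<forall>\<^sub>F v in nhds (snd p). (fst p, v) \<in> U"
    by simp_all
  then have "\<forall>\<^sub>F u in nhds (fst p). f (u, snd p) = g (u, snd p)"
    "\<forall>\<^sub>F v in nhds (snd p). f (fst p, v) = g (fst p, v)"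
    using assms(3) by (auto elim: eventually_mono)
  then show "partial_x f p = partial_x g p" and "partial_y f p = partial_y g p"
    unfolding partial_x_def partial_y_def
    by (auto intro!: vector_derivative_cong_eq)
qed

lemma double_difference_mean_value:
  fixes f fx fxy :: "real \<Rightarrow> real \<Rightarrow> real"
  assumes "h > 0"
    and fx: "\<And>u v. u \<in> {a..a + h} \<Longrightarrow> v \<in> {b..b + h} \<Longrightarrow>
      ((\<lambda>u. f u v) has_real_derivative fx u v) (at u)"
    and fxy: "\<And>u v. u \<in> {a..a + h} \<Longrightarrow> v \<in> {b..b + h} \<Longrightarrow>
      ((\<lambda>v. fx u v) has_real_derivative fxy u v) (at v)"
  shows "\<exists>u\<in>{a..a + h}. \<exists>v\<in>{b..b + h}.
    f (a + h) (b + h) - f (a + h) b - f a (b + h) + f a b = h\<^sup>2 * fxy u v"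
proof -
  have "\<exists>u>a. u < a + h \<and> (f (a + h) (b + h) - f (a + h) b) - (f a (b + h) - f a b)
      = (a + h - a) * (fx u (b + h) - fx u b)"
    using assms(1) by (intro MVT2 DERIV_diff fx) auto
  then obtain u where "a < u" "u < a + h"
    "(f (a + h) (b + h) - f (a + h) b) - (f a (b + h) - f a b) = (a + h - a) * (fx u (b + h) - fx u b)"
    by blast
  then have u: "u \<in> {a..a + h}"
    "(f (a + h) (b + h) - f (a + h) b) - (f a (b + h) - f a b) = h * (fx u (b + h) - fx u b)"
    by auto
  have "\<exists>v>b. v < b + h \<and> fx u (b + h) - fx u b = (b + h - b) * fxy u v"
    using assms(1) u(1) by (intro MVT2 fxy) auto
  then obtain v where "b < v" "v < b + h" "fx u (b + h) - fx u b = (b + h - b) * fxy u v"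
    by blast
  then have v: "v \<in> {b..b + h}" "fx u (b + h) - fx u b = h * fxy u v"
    by auto
  from u(2) have "f (a + h) (b + h) - f (a + h) b - f a (b + h) + f a b = h * (h * fxy u v)"
    unfolding v(2) by simp
  then show ?thesis
    using u(1) v(1) by (metis mult.assoc power2_eq_square)
qed

text \<open>The double difference over a small square is symmetric in the two variables. Taking mean
  values in either order makes it h^2 times either mixed partial at some point of the square. By
  continuity these values lie within \<epsilon> of their values at (a, b), which are 2 \<epsilon>
  apart.\<close>

lemma mixed_partials_commute:
  assumes "open U" "(a, b) \<in> U" "Ck_on 2 U f"
  shows "partial_y (partial_x f) (a, b) = partial_x (partial_y f) (a, b)"
proof (rule ccontr)
  assume neq: "partial_y (partial_x f) (a, b) \<noteq> partial_x (partial_y f) (a, b)"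
  define \<epsilon> where "\<epsilon> = dist (partial_y (partial_x f) (a, b)) (partial_x (partial_y f) (a, b)) / 2"
  have \<epsilon>: "\<epsilon> > 0"
    using neq by (simp add: \<epsilon>_def)
  have diff: "f differentiable (at q)" "partial_x f differentiable (at q)"
    "partial_y f differentiable (at q)" if "q \<in> U" for q
    using assms(3) that by (auto simp: numeral_2_eq_2)
  have cont: "isCont (partial_y (partial_x f)) (a, b)" "isCont (partial_x (partial_y f)) (a, b)"
    using assms by (auto simp: numeral_2_eq_2 continuous_on_eq_continuous_at)
  have "\<forall>\<^sub>F q in nhds (a, b). q \<in> U \<and> dist (partial_y (partial_x f) q) (partial_y (partial_x f) (a, b)) < \<epsilon>
      \<and> dist (partial_x (partial_y f) q) (partial_x (partial_y f) (a, b)) < \<epsilon>"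
    using assms(1,2) cont \<epsilon> unfolding isCont_def tendsto_at_iff_tendsto_nhds
    by (intro eventually_conj eventually_nhds_in_open tendstoD) auto
  then obtain d where d: "d > 0" and near: "\<And>q. dist q (a, b) < d \<Longrightarrow> q \<in> U
      \<and> dist (partial_y (partial_x f) q) (partial_y (partial_x f) (a, b)) < \<epsilon>
      \<and> dist (partial_x (partial_y f) q) (partial_x (partial_y f) (a, b)) < \<epsilon>"
    unfolding eventually_nhds_metric by blast
  \<comment> \<open>Points of the square differ from the corner by at most 2 d / 3 in the sum of
    coordinate distances, hence by less than d.\<close>
  define h where "h = d / 3"
  have h: "h > 0"
    using d by (simp add: h_def)
  have dist_less: "dist (u, v) (a, b) < d" if "u \<in> {a..a + h}" "v \<in> {b..b + h}" for u v
  proof -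
    have "dist (u, v) (a, b) \<le> \<bar>u - a\<bar> + \<bar>v - b\<bar>"
      unfolding dist_Pair_Pair dist_real_def by (rule sqrt_sum_squares_le_sum) auto
    also have "\<dots> < d"
      using that d by (auto simp: h_def)
    finally show ?thesis .
  qed
  have dx: "((\<lambda>u. g (u, v)) has_real_derivative partial_x g (u, v)) (at u)"
    and dy: "((\<lambda>v. g (u, v)) has_real_derivative partial_y g (u, v)) (at v)"
    if "g differentiable (at (u, v))" for g and u v :: real
    using has_vector_derivative_partial_x[OF that] has_vector_derivative_partial_y[OF that]
    by (auto simp: has_real_derivative_iff_has_vector_derivative)
  have d1: "\<exists>u\<in>{a..a + h}. \<exists>v\<in>{b..b + h}. f (a + h, b + h) - f (a + h, b) - f (a, b + h) + f (a, b)
      = h\<^sup>2 * partial_y (partial_x f) (u, v)"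
    using near[OF dist_less] diff
    by (intro double_difference_mean_value[of h a b "\<lambda>u v. f (u, v)" "\<lambda>u v. partial_x f (u, v)"] h dx dy) blast+
  have d2: "\<exists>v\<in>{b..b + h}. \<exists>u\<in>{a..a + h}. f (a + h, b + h) - f (a, b + h) - f (a + h, b) + f (a, b)
      = h\<^sup>2 * partial_x (partial_y f) (u, v)"
    using near[OF dist_less] diff
    by (intro double_difference_mean_value[of h b a "\<lambda>v u. f (u, v)" "\<lambda>v u. partial_y f (u, v)"] h dx dy) blast+
  from d1 obtain u v where uv: "u \<in> {a..a + h}" "v \<in> {b..b + h}" and
    "f (a + h, b + h) - f (a + h, b) - f (a, b + h) + f (a, b) = h\<^sup>2 * partial_y (partial_x f) (u, v)"
    by blast
  moreover from d2 obtain v' u' where uv': "v' \<in> {b..b + h}" "u' \<in> {a..a + h}" and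
    "f (a + h, b + h) - f (a, b + h) - f (a + h, b) + f (a, b) = h\<^sup>2 * partial_x (partial_y f) (u', v')"
    by blast
  ultimately have "h\<^sup>2 * partial_y (partial_x f) (u, v) = h\<^sup>2 * partial_x (partial_y f) (u', v')"
    by linarith
  then have "partial_y (partial_x f) (u, v) = partial_x (partial_y f) (u', v')"
    using h by simp
  then show False
    using near[OF dist_less[OF uv]] near[OF dist_less[OF uv'(2,1)]]
      dist_triangle3[of "partial_y (partial_x f) (a, b)" "partial_x (partial_y f) (a, b)"
        "partial_y (partial_x f) (u, v)"]
    by (simp add: \<epsilon>_def)
qed

lemma interior_newton_polygon_subset: "interior newton_polygon \<subseteq> {0<..<1} \<times> {0<..<1}"
proof -
  have "newton_polygon \<subseteq> {0..1} \<times> {0..1}"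
    unfolding newton_polygon_def by (intro hull_minimal convex_Times) auto
  then have "interior newton_polygon \<subseteq> interior ({0..1} \<times> {0..1})"
    by (rule interior_mono)
  then show ?thesis
    by (simp add: interior_Times)
qed

text \<open>For an exponential the logarithmic derivative is the derivative of the exponent, with no
  branch of the logarithm to choose. This splits Ampere's equation into an equation for moduli and
  one for arguments.\<close>

lemma polar_form_derivatives:
  fixes A B :: "real \<times> real \<Rightarrow> real"
  assumes "A differentiable (at p)" "B differentiable (at p)"
  defines "z \<equiv> (\<lambda>q. exp (Complex (A q) (B q)))"
  shows "z differentiable (at p)"
    and "partial_x z p / z p = Complex (partial_x A p) (partial_x B p)"
    and "partial_y z p / z p = Complex (partial_y A p) (partial_y B p)"
proof -
  obtain A' B' where "(A has_derivative A') (at p)" "(B has_derivative B') (at p)"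
    using assms by (auto simp: differentiable_def)
  then have "((\<lambda>q. of_real (A q) + \<i> * of_real (B q)) has_derivative
      (\<lambda>q. of_real (A' q) + \<i> * of_real (B' q))) (at p)"
    by (auto intro!: derivative_eq_intros)
  then have "(\<lambda>q. Complex (A q) (B q)) differentiable (at p)"
    unfolding Complex_eq by (rule differentiableI)
  then show "z differentiable (at p)"
    unfolding z_def
    by (rule differentiable_compose[of exp, rotated]) (rule differentiableI[OF has_field_derivative_imp_has_derivative[OF DERIV_exp]])
  have chain: "((\<lambda>u. exp (Complex (f u) (g u))) has_vector_derivative
      Complex f' g' * exp (Complex (f x) (g x))) (at x)"
    if "(f has_vector_derivative f') (at x)" "(g has_vector_derivative g') (at x)"
    for f g :: "real \<Rightarrow> real" and f' g' x
  proof -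
    have "((\<lambda>u. of_real (f u) + \<i> * of_real (g u)) has_vector_derivative of_real f' + \<i> * of_real g') (at x)"
      using that by (intro has_vector_derivative_add has_vector_derivative_mult_right has_vector_derivative_of_real)
        (auto simp: has_real_derivative_iff_has_vector_derivative)
    then have "((\<lambda>u. Complex (f u) (g u)) has_vector_derivative Complex f' g') (at x)"
      by (simp add: Complex_eq)
    from field_vector_diff_chain_at[OF this DERIV_exp] show ?thesis
      by (simp add: o_def)
  qed
  obtain x y where p: "p = (x, y)"
    by (cases p)
  note d = assms(1,2)[unfolded p]
  show "partial_x z p / z p = Complex (partial_x A p) (partial_x B p)"
    using vector_derivative_at[OF chain[OF d[THEN has_vector_derivative_partial_x]]]
    unfolding p z_def partial_x_def[of "\<lambda>q. exp (Complex (A q) (B q))"] by simp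
  show "partial_y z p / z p = Complex (partial_y A p) (partial_y B p)"
    using vector_derivative_at[OF chain[OF d[THEN has_vector_derivative_partial_y]]]
    unfolding p z_def partial_y_def[of "\<lambda>q. exp (Complex (A q) (B q))"] by simp
qed

section \<open>The spectral curve in terms of the slopes\<close>

lemma exp_minus_dual_coord:
  assumes "0 < s" "s < 1" "0 < t" "t < 1"
  shows "exp (- dual_coord s t) = (cos (pi * s) * sin (pi * t)
    + sqrt (1 - (cos (pi * s) * cos (pi * t))\<^sup>2)) / sin (pi * s)"
proof -
  have sin_s: "sin (pi * s) > 0"
    using assms by (intro sin_gt_zero) auto
  have "exp (- dual_coord s t) = cosh (dual_coord s t) - sinh (dual_coord s t)"
    by (simp add: cosh_minus_sinh)
  also have "\<dots> = cosh (dual_coord s t) + cot (pi * s) * sin (pi * t)"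
    by (simp add: dual_coord_def)
  finally show ?thesis
    using sin_s cosh_dual_coord[OF assms] by (simp add: cot_def add_divide_distrib eq_divide_eq algebra_simps)
qed

text \<open>The conclusions are the real and imaginary parts of P(z, w) = 0 for z = \<rho> (c - i d)
  and w = r (a + i b), where (a, b) and (c, d) are the cosine and sine of pi s and pi t. Multiplying
  by b d clears denominators and leaves an expression affine in D; both of its coefficients vanish
  on the two unit circles.\<close>

lemma domino_poly_polar_identity:
  fixes a b c d D \<rho> r :: real
  assumes \<rho>: "b * \<rho> = a * d + D" and r: "d * r = c * b + D"
    and ab: "a\<^sup>2 + b\<^sup>2 = 1" and cd: "c\<^sup>2 + d\<^sup>2 = 1" and D: "D\<^sup>2 = 1 - (a * c)\<^sup>2"
    and pos: "b > 0" "d > 0"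
  shows "1 + \<rho> * c + r * a - \<rho> * r * (a * c + b * d) = 0"
    and "r * b - \<rho> * d - \<rho> * r * (b * c - a * d) = 0"
proof -
  have a: "a\<^sup>2 = 1 - b\<^sup>2" and c: "c\<^sup>2 = 1 - d\<^sup>2"
    using ab cd by auto
  \<comment> \<open>Replacing D^2 here is what keeps the product \<rho> r, up to the factor b d,
    affine in D.\<close>
  have UV: "(a * d + D) * (c * b + D) = a * b * c * d + D * (a * d + c * b) + (1 - a\<^sup>2 * c\<^sup>2)"
    using D by (simp add: power2_eq_square algebra_simps)
  have "(b * d) * (1 + \<rho> * c + r * a - \<rho> * r * (a * c + b * d))
      = b * d + (b * \<rho>) * (c * d) + (d * r) * (a * b) - (b * \<rho>) * (d * r) * (a * c + b * d)"
    by (simp add: algebra_simps)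
  also have "\<dots> = (b * d + a * c * (b\<^sup>2 + d\<^sup>2) - (a * b * c * d + (1 - a\<^sup>2 * c\<^sup>2)) * (a * c + b * d))
      + D * (c * d + a * b - (a * d + c * b) * (a * c + b * d))"
    unfolding \<rho> r UV by (simp add: power2_eq_square algebra_simps)
  also have "(a * d + c * b) * (a * c + b * d) = c * d * (a\<^sup>2 + b\<^sup>2) + a * b * (c\<^sup>2 + d\<^sup>2)"
    by (simp add: power2_eq_square algebra_simps)
  also have "b * d + a * c * (b\<^sup>2 + d\<^sup>2) - (a * b * c * d + (1 - a\<^sup>2 * c\<^sup>2)) * (a * c + b * d)
      = a * c * (b\<^sup>2 + d\<^sup>2 - 1 - b\<^sup>2 * d\<^sup>2 + a\<^sup>2 * c\<^sup>2)"
    by (simp add: power2_eq_square algebra_simps)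
  also have "b\<^sup>2 + d\<^sup>2 - 1 - b\<^sup>2 * d\<^sup>2 + a\<^sup>2 * c\<^sup>2 = 0"
    unfolding a c by (simp add: algebra_simps)
  finally show "1 + \<rho> * c + r * a - \<rho> * r * (a * c + b * d) = 0"
    using pos by (simp add: ab cd)
  have "(b * d) * (r * b - \<rho> * d - \<rho> * r * (b * c - a * d))
      = (d * r) * b\<^sup>2 - (b * \<rho>) * d\<^sup>2 - (b * \<rho>) * (d * r) * (b * c - a * d)"
    by (simp add: power2_eq_square algebra_simps)
  also have "\<dots> = (c * b * (b\<^sup>2 - 1 + a\<^sup>2 * c\<^sup>2 + a\<^sup>2 * d\<^sup>2) - a * d * (d\<^sup>2 - 1 + a\<^sup>2 * c\<^sup>2 + b\<^sup>2 * c\<^sup>2))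
      + D * (b\<^sup>2 - d\<^sup>2 - (b\<^sup>2 * c\<^sup>2 - a\<^sup>2 * d\<^sup>2))"
    unfolding \<rho> r UV by (simp add: power2_eq_square algebra_simps)
  also have "b\<^sup>2 - 1 + a\<^sup>2 * c\<^sup>2 + a\<^sup>2 * d\<^sup>2 = 0"
    unfolding a c by (simp add: algebra_simps)
  also have "d\<^sup>2 - 1 + a\<^sup>2 * c\<^sup>2 + b\<^sup>2 * c\<^sup>2 = 0"
    unfolding a c by (simp add: algebra_simps)
  also have "b\<^sup>2 - d\<^sup>2 - (b\<^sup>2 * c\<^sup>2 - a\<^sup>2 * d\<^sup>2) = 0"
    unfolding a c by (simp add: algebra_simps)
  finally show "r * b - \<rho> * d - \<rho> * r * (b * c - a * d) = 0"
    using pos by simp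
qed

lemma domino_poly_dual_coord:
  assumes "0 < s" "s < 1" "0 < t" "t < 1"
  shows "domino_poly (exp (Complex (- dual_coord s t) (- (pi * t))))
    (exp (Complex (- dual_coord t s) (pi * s))) = 0"
proof -
  define a b c d D where "a = cos (pi * s)" and "b = sin (pi * s)" and "c = cos (pi * t)"
    and "d = sin (pi * t)" and "D = sqrt (1 - (a * c)\<^sup>2)"
  define \<rho> r where "\<rho> = exp (- dual_coord s t)" and "r = exp (- dual_coord t s)"
  have pos: "b > 0" "d > 0"
    unfolding b_def d_def using assms by (auto intro!: sin_gt_zero)
  have \<rho>: "b * \<rho> = a * d + D"
    using exp_minus_dual_coord[OF assms] pos by (simp add: \<rho>_def a_def b_def c_def d_def D_def)
  have r: "d * r = c * b + D"
    using exp_minus_dual_coord[of t s] assms pos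
    by (simp add: r_def a_def b_def c_def d_def D_def mult.commute)
  have ab: "a\<^sup>2 + b\<^sup>2 = 1" and cd: "c\<^sup>2 + d\<^sup>2 = 1"
    by (auto simp: a_def b_def c_def d_def)
  have "\<bar>a * c\<bar> \<le> 1"
    unfolding abs_mult a_def c_def by (intro mult_le_one) auto
  then have D: "D\<^sup>2 = 1 - (a * c)\<^sup>2"
    unfolding D_def by (simp add: abs_square_le_1)
  note identity = domino_poly_polar_identity[OF \<rho> r ab cd D pos]
  have z: "exp (Complex (- dual_coord s t) (- (pi * t))) = Complex (\<rho> * c) (- \<rho> * d)"
    by (simp add: complex_eq_iff Re_exp Im_exp \<rho>_def c_def d_def)
  have w: "exp (Complex (- dual_coord t s) (pi * s)) = Complex (r * a) (r * b)"
    by (simp add: complex_eq_iff Re_exp Im_exp r_def a_def b_def)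
  show ?thesis
    unfolding domino_poly_def z w complex_eq_iff using identity by (simp add: algebra_simps)
qed

lemma differentiable_dual_coord:
  fixes f g :: "real \<times> real \<Rightarrow> real"
  assumes "f differentiable (at p)" "g differentiable (at p)" "0 < f p" "f p < 1"
  shows "(\<lambda>q. dual_coord (f q) (g q)) differentiable (at p)"
proof -
  obtain f' g' where "(f has_derivative f') (at p)" "(g has_derivative g') (at p)"
    using assms by (auto simp: differentiable_def)
  moreover have "sin (pi * f p) \<noteq> 0"
    using assms sin_gt_zero[of "pi * f p"] by simp
  ultimately have "\<exists>F. ((\<lambda>q. cot (pi * f q) * sin (pi * g q)) has_derivative F) (at p)"
    unfolding cot_def by (intro exI) (rule derivative_eq_intros refl | assumption)+
  then have "(\<lambda>q. cot (pi * f q) * sin (pi * g q)) differentiable (at p)"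
    by (simp add: differentiable_def)
  then have "(\<lambda>q. arsinh (cot (pi * f q) * sin (pi * g q))) differentiable (at p)"
    by (rule differentiable_compose[of arsinh, rotated])
      (rule differentiableI[OF has_field_derivative_imp_has_derivative[OF arsinh_real_has_field_derivative]])
  then show ?thesis
    unfolding dual_coord_def by (rule differentiable_minus)
qed

theorem theorem1:
  fixes \<Omega> L :: "(real \<times> real) set" and b h :: "real \<times> real \<Rightarrow> real"
  assumes "open \<Omega>" and "connected \<Omega>" and "\<Omega> \<noteq> {}" and "bounded \<Omega>"
    and "minimizer \<Omega> b h"
    and "L = liquid_region \<Omega> h"
    and "open L" and "smooth_on L h" and "euler_lagrange_on L h"
  shows "\<exists>z w :: real \<times> real \<Rightarrow> complex.
    \<forall>p\<in>L. z p \<noteq> 0 \<and> w p \<noteq> 0 \<and>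
      z differentiable (at p) \<and> w differentiable (at p) \<and>
      gradient h p = (1 / pi) *\<^sub>R (Arg (w p), - Arg (z p)) \<and>
      partial_x z p / z p + partial_y w p / w p = 0 \<and>
      domino_poly (z p) (w p) = 0"
proof -
  define s t where "s = partial_x h" and "t = partial_y h"
  define X Y where "X q = dual_coord (s q) (t q)" and "Y q = dual_coord (t q) (s q)" for q
  define z w where "z q = exp (Complex (- X q) (- pi * t q))"
    and "w q = exp (Complex (- Y q) (pi * s q))" for q
  have "z p \<noteq> 0 \<and> w p \<noteq> 0 \<and> z differentiable (at p) \<and> w differentiable (at p) \<and>
      gradient h p = (1 / pi) *\<^sub>R (Arg (w p), - Arg (z p)) \<and>
      partial_x z p / z p + partial_y w p / w p = 0 \<and> domino_poly (z p) (w p) = 0"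
    if p: "p \<in> L" for p
  proof (intro conjI)
    have slopes: "0 < s q" "s q < 1" "0 < t q" "t q < 1" if "q \<in> L" for q
      using that assms(6) interior_newton_polygon_subset
      by (auto simp: liquid_region_def gradient_def s_def t_def)
    have "Ck_on 2 L h"
      using assms(8) by (simp add: smooth_on_def)
    then have st: "s differentiable (at p)" "t differentiable (at p)"
      using p by (auto simp: numeral_2_eq_2 s_def t_def)
    have XY: "X differentiable (at p)" "Y differentiable (at p)"
      unfolding X_def Y_def using st slopes[OF p] by (intro differentiable_dual_coord; simp)+
    have args: "(\<lambda>q. - X q) differentiable (at p)" "(\<lambda>q. - pi * t q) differentiable (at p)"
      "(\<lambda>q. - Y q) differentiable (at p)" "(\<lambda>q. pi * s q) differentiable (at p)"
      using XY st by (auto intro!: differentiable_minus differentiable_mult differentiable_const)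
    show "z p \<noteq> 0" "w p \<noteq> 0"
      by (simp_all add: z_def w_def)
    show "z differentiable (at p)" "w differentiable (at p)"
      unfolding z_def[abs_def] w_def[abs_def]
      using polar_form_derivatives(1)[OF args(1,2)] polar_form_derivatives(1)[OF args(3,4)] by auto
    \<comment> \<open>Slopes strictly inside the square keep pi s and - pi t in the open range (-pi,
      pi) of the principal argument, so \<open>Arg\<close> returns them without a multiple of 2
      pi.\<close>
    have "0 < pi * s p" "pi * s p < pi" "0 < pi * t p" "pi * t p < pi"
      using slopes[OF p] by auto
    then have "Arg (w p) = pi * s p" "Arg (z p) = - pi * t p"
      unfolding w_def z_def by (subst Arg_exp; simp del: pi_gt_zero)+
    then show "gradient h p = (1 / pi) *\<^sub>R (Arg (w p), - Arg (z p))"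
      by (simp add: gradient_def s_def t_def)
    show "domino_poly (z p) (w p) = 0"
      using domino_poly_dual_coord[OF slopes[OF p]] by (simp add: z_def w_def X_def Y_def)
    obtain x y where xy: "p = (x, y)"
      by (cases p)
    \<comment> \<open>The slopes lie inside the square on all of the open set \<open>L\<close>, so
      the gradient formula holds near \<open>p\<close> and may be differentiated there; equality at
      \<open>p\<close> alone would not determine the derivative.\<close>
    have "partial_x (\<lambda>q. partial_x surface_tension (gradient h q)) p = partial_x X p"
      by (rule partial_cong(1)[OF assms(7) p])
        (use slopes in \<open>simp add: gradient_def X_def s_def t_def partial_surface_tension\<close>)
    moreover have "partial_y (\<lambda>q. partial_y surface_tension (gradient h q)) p = partial_y Y p"
      by (rule partial_cong(2)[OF assms(7) p])
        (use slopes in \<open>simp add: gradient_def Y_def s_def t_def partial_surface_tension\<close>)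
    moreover have "partial_x (\<lambda>q. partial_x surface_tension (gradient h q)) p
        + partial_y (\<lambda>q. partial_y surface_tension (gradient h q)) p = 0"
      using assms(9) p unfolding euler_lagrange_on_def by blast
    ultimately have el: "partial_x X p + partial_y Y p = 0"
      by linarith
    have mixed: "partial_y s p = partial_x t p"
      unfolding s_def t_def xy
      by (rule mixed_partials_commute[OF assms(7) p[unfolded xy] \<open>Ck_on 2 L h\<close>])
    have X': "partial_x (\<lambda>q. - X q) p = - partial_x X p" "partial_y (\<lambda>q. - Y q) p = - partial_y Y p"
      using XY unfolding xy
      by (auto simp: partial_x_def[of "\<lambda>q. - X q"] partial_y_def[of "\<lambda>q. - Y q"]
          intro!: vector_derivative_at has_vector_derivative_minus
            has_vector_derivative_partial_x has_vector_derivative_partial_y)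
    have s': "partial_x (\<lambda>q. - pi * t q) p = - pi * partial_x t p" "partial_y (\<lambda>q. pi * s q) p = pi * partial_y s p"
      using st unfolding xy partial_x_def[of "\<lambda>q. - pi * t q"] partial_y_def[of "\<lambda>q. pi * s q"]
      by (auto intro!: vector_derivative_at has_vector_derivative_mult_right has_vector_derivative_minus
            has_vector_derivative_partial_x has_vector_derivative_partial_y)
    have "partial_x z p / z p = Complex (- partial_x X p) (- pi * partial_x t p)"
      using polar_form_derivatives(2)[OF args(1,2)] unfolding X' s' by (simp only: z_def[abs_def])
    moreover have "partial_y w p / w p = Complex (- partial_y Y p) (pi * partial_y s p)"
      using polar_form_derivatives(3)[OF args(3,4)] unfolding X' s' by (simp only: w_def[abs_def])
    ultimately show "partial_x z p / z p + partial_y w p / w p = 0"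
      using el mixed by (simp add: complex_eq_iff)
  qed
  then show ?thesis
    by blast
qed

end
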